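(* Let $A$ be a local commutative ring, $N$ its nilradical, $E$ a non-zero $A$-module and $R=A\propto E$ the trivial ring extension of $A$ by $E$. Then $R$ is an fqp-ring if and only if $A$ is an fqp-ring and one of the following holds: (1) $A$ is a valuation domain and $E$ is divisible and uniserial; (2) $NE=0$ and $E$ is divisible and torsionfree as an $A/N$-module, each zero-divisor of $A$ belongs to $N$, and $N^2=0$.
   Context: The trivial ring extension $R=A\propto E$ is the ring with underlying group $A\times E$ and multiplication $(a,e)(a',e')=(aa',ae'+a'e)$. An $A$-module $V$ is $M$-projective if $\mathrm{Hom}_A(V,M)\to\mathrm{Hom}_A(V,M/X)$ is surjective for every submodule $X$ of $M$; $V$ is quasi-projective if it is $V$-projective. A ring is an fqp-ring if every finitely generated ideal is quasi-projective. A module is uniserial if its submodules are totally ordered by inclusion. *)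

theory Defs
  imports "HOL-Algebra.Module" "HOL-Algebra.Ideal_Product"
begin

definition local_ring :: "('a, 'c) ring_scheme \<Rightarrow> bool" where
  "local_ring A \<longleftrightarrow> cring A \<and> (\<exists>!I. maximalideal I A)"

definition nilradical :: "('a, 'c) ring_scheme \<Rightarrow> 'a set" where
  "nilradical A = {a \<in> carrier A. \<exists>n::nat. a [^]\<^bsub>A\<^esub> n = \<zero>\<^bsub>A\<^esub>}"

definition zero_divisor :: "('a, 'c) ring_scheme \<Rightarrow> 'a \<Rightarrow> bool" where
  "zero_divisor A a \<longleftrightarrow> a \<in> carrier A \<and>
     (\<exists>b\<in>carrier A. b \<noteq> \<zero>\<^bsub>A\<^esub> \<and> a \<otimes>\<^bsub>A\<^esub> b = \<zero>\<^bsub>A\<^esub>)"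

definition regular_elem :: "('a, 'c) ring_scheme \<Rightarrow> 'a \<Rightarrow> bool" where
  "regular_elem A a \<longleftrightarrow> a \<in> carrier A \<and> \<not> zero_divisor A a"

definition valuation_domain :: "('a, 'c) ring_scheme \<Rightarrow> bool" where
  "valuation_domain A \<longleftrightarrow> domain A \<and>
     (\<forall>a\<in>carrier A. \<forall>b\<in>carrier A.
       (\<exists>c\<in>carrier A. b = a \<otimes>\<^bsub>A\<^esub> c) \<or> (\<exists>c\<in>carrier A. a = b \<otimes>\<^bsub>A\<^esub> c))"

definition divisible_module :: "('a, 'c) ring_scheme \<Rightarrow> ('a, 'b) module \<Rightarrow> bool" where
  "divisible_module A E \<longleftrightarrow>
     (\<forall>r. regular_elem A r \<longrightarrow> (\<forall>e\<in>carrier E. \<exists>e'\<in>carrier E. e = r \<odot>\<^bsub>E\<^esub> e'))"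

definition uniserial :: "('a, 'c) ring_scheme \<Rightarrow> ('a, 'b) module \<Rightarrow> bool" where
  "uniserial A E \<longleftrightarrow>
     (\<forall>H K. submodule H A E \<longrightarrow> submodule K A E \<longrightarrow> H \<subseteq> K \<or> K \<subseteq> H)"

text \<open>When \<open>NE = 0\<close>, \<open>E\<close> is an \<open>A/N\<close>-module via \<open>(a + N) e = a e\<close>.  The class
  \<open>a + N\<close> is regular in \<open>A/N\<close> iff \<open>a b \<in> N\<close> implies \<open>b \<in> N\<close> for all \<open>b \<in> A\<close>.\<close>
definition regular_mod_nil :: "('a, 'c) ring_scheme \<Rightarrow> 'a \<Rightarrow> bool" where
  "regular_mod_nil A a \<longleftrightarrow> a \<in> carrier A \<and>
     (\<forall>b\<in>carrier A. a \<otimes>\<^bsub>A\<^esub> b \<in> nilradical A \<longrightarrow> b \<in> nilradical A)"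

definition divisible_mod_nil :: "('a, 'c) ring_scheme \<Rightarrow> ('a, 'b) module \<Rightarrow> bool" where
  "divisible_mod_nil A E \<longleftrightarrow>
     (\<forall>a. regular_mod_nil A a \<longrightarrow> (\<forall>e\<in>carrier E. \<exists>e'\<in>carrier E. e = a \<odot>\<^bsub>E\<^esub> e'))"

definition torsionfree_mod_nil :: "('a, 'c) ring_scheme \<Rightarrow> ('a, 'b) module \<Rightarrow> bool" where
  "torsionfree_mod_nil A E \<longleftrightarrow>
     (\<forall>a. regular_mod_nil A a \<longrightarrow>
        (\<forall>e\<in>carrier E. a \<odot>\<^bsub>E\<^esub> e = \<zero>\<^bsub>E\<^esub> \<longrightarrow> e = \<zero>\<^bsub>E\<^esub>))"

definition triv_ext :: "('a, 'c) ring_scheme \<Rightarrow> ('a, 'b) module \<Rightarrow> ('a \<times> 'b) ring" where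
  "triv_ext A E = \<lparr>
     carrier = carrier A \<times> carrier E,
     mult = (\<lambda>(a, e) (a', e'). (a \<otimes>\<^bsub>A\<^esub> a', (a \<odot>\<^bsub>E\<^esub> e') \<oplus>\<^bsub>E\<^esub> (a' \<odot>\<^bsub>E\<^esub> e))),
     one = (\<one>\<^bsub>A\<^esub>, \<zero>\<^bsub>E\<^esub>),
     zero = (\<zero>\<^bsub>A\<^esub>, \<zero>\<^bsub>E\<^esub>),
     add = (\<lambda>(a, e) (a', e'). (a \<oplus>\<^bsub>A\<^esub> a', e \<oplus>\<^bsub>E\<^esub> e')) \<rparr>"

text \<open>For ideals \<open>V, M\<close> of \<open>R\<close> (viewed as \<open>R\<close>-modules), \<open>V\<close> is \<open>M\<close>-projective iff for
  every submodule \<open>X\<close> of \<open>M\<close> (= ideal of \<open>R\<close> contained in \<open>M\<close>) every \<open>R\<close>-linear map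
  \<open>V \<rightarrow> M/X\<close> lifts to an \<open>R\<close>-linear map \<open>V \<rightarrow> M\<close>.  A map \<open>h : V \<rightarrow> M/X\<close> is represented
  by a function \<open>g : V \<rightarrow> M\<close> with \<open>h v = g v + X\<close>; \<open>h\<close> is linear iff \<open>g\<close> is linear
  modulo \<open>X\<close>, and \<open>f\<close> lifts \<open>h\<close> iff \<open>f v - g v \<in> X\<close> for all \<open>v\<close>.\<close>
definition lin_on :: "('a, 'c) ring_scheme \<Rightarrow> 'a set \<Rightarrow> ('a \<Rightarrow> 'a) \<Rightarrow> bool" where
  "lin_on R V f \<longleftrightarrow>
     (\<forall>x\<in>V. \<forall>y\<in>V. f (x \<oplus>\<^bsub>R\<^esub> y) = f x \<oplus>\<^bsub>R\<^esub> f y) \<and>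
     (\<forall>r\<in>carrier R. \<forall>x\<in>V. f (r \<otimes>\<^bsub>R\<^esub> x) = r \<otimes>\<^bsub>R\<^esub> f x)"

definition lin_mod_on :: "('a, 'c) ring_scheme \<Rightarrow> 'a set \<Rightarrow> 'a set \<Rightarrow> ('a \<Rightarrow> 'a) \<Rightarrow> bool" where
  "lin_mod_on R V X g \<longleftrightarrow>
     (\<forall>x\<in>V. \<forall>y\<in>V. g (x \<oplus>\<^bsub>R\<^esub> y) \<ominus>\<^bsub>R\<^esub> (g x \<oplus>\<^bsub>R\<^esub> g y) \<in> X) \<and>
     (\<forall>r\<in>carrier R. \<forall>x\<in>V. g (r \<otimes>\<^bsub>R\<^esub> x) \<ominus>\<^bsub>R\<^esub> (r \<otimes>\<^bsub>R\<^esub> g x) \<in> X)"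

definition ideal_M_projective :: "('a, 'c) ring_scheme \<Rightarrow> 'a set \<Rightarrow> 'a set \<Rightarrow> bool" where
  "ideal_M_projective R V M \<longleftrightarrow>
     (\<forall>X. ideal X R \<longrightarrow> X \<subseteq> M \<longrightarrow>
        (\<forall>g. g \<in> V \<rightarrow> M \<longrightarrow> lin_mod_on R V X g \<longrightarrow>
           (\<exists>f. f \<in> V \<rightarrow> M \<and> lin_on R V f \<and> (\<forall>v\<in>V. f v \<ominus>\<^bsub>R\<^esub> g v \<in> X))))"

definition quasi_projective_ideal :: "('a, 'c) ring_scheme \<Rightarrow> 'a set \<Rightarrow> bool" where
  "quasi_projective_ideal R I \<longleftrightarrow> ideal_M_projective R I I"

definition fqp_ring :: "('a, 'c) ring_scheme \<Rightarrow> bool" where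
  "fqp_ring R \<longleftrightarrow>
     (\<forall>S. finite S \<longrightarrow> S \<subseteq> carrier R \<longrightarrow> quasi_projective_ideal R (Idl\<^bsub>R\<^esub> S))"

end

theory Submission
  imports Defs "HOL-Algebra.Divisibility"
begin

text \<open>
  A local ring \<open>R\<close> is an fqp-ring iff any two elements \<open>a\<close>, \<open>b\<close> are either comparable for
  divisibility or independent: \<open>ra + sb = 0\<close> forces \<open>r\<close> and \<open>s\<close> to annihilate both \<open>a\<close> and \<open>b\<close>.
  Independence of incomparable \<open>a\<close>, \<open>b\<close> follows by lifting two maps from \<open>(a, b)\<close> into its quotients
  and using that \<open>1 + x\<close> is a unit for each non-unit \<open>x\<close>. Conversely, if \<open>S\<close> is a finite generating
  set of least cardinality of an ideal \<open>I\<close>, all coefficients of every relation between the elements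
  of \<open>S\<close> annihilate \<open>I\<close>, so a linear map from \<open>I\<close> to a quotient of \<open>I\<close> lifts by prescribing it on
  \<open>S\<close>.

  For \<open>R = A \<propto> E\<close>, comparing \<open>(a, 0)\<close> with \<open>(0, e)\<close> shows that each \<open>a \<noteq> 0\<close> satisfies
  \<open>aE = E\<close>, or else \<open>a\<^sup>2 = 0\<close>, \<open>aE = 0\<close> and \<open>a\<close> has the same annihilator as every non-zero
  element of \<open>E\<close>. The second alternative holds for the non-zero nilpotent elements, which gives case
  (2) if there are any. If \<open>A\<close> is reduced, it is a valuation domain and \<open>E\<close> is divisible; then two
  elements of \<open>E\<close> that generate incomparable submodules have zero annihilator, and \<open>E\<close> is torsionfree.
\<close>

section \<open>Local rings\<close>

text \<open>Locality is expressed through elements so that it passes to the trivial extension via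
  first components, without classifying maximal ideals there.\<close>

locale local_cring = cring +
  assumes one_not_zero: "\<one> \<noteq> \<zero>"
    and unit_or_unit: "x \<in> carrier R \<Longrightarrow> x \<in> Units R \<or> \<one> \<ominus> x \<in> Units R"

text \<open>Zorn's lemma applies to the ideals that contain \<open>I\<close> and avoid
  \<open>\<one>\<close>: properness means missing one fixed element, which survives unions of
  chains.\<close>

lemma (in cring) exists_maximalideal:
  assumes I: "ideal I R" and one: "\<one> \<notin> I"
  shows "\<exists>M. maximalideal M R \<and> I \<subseteq> M"
proof -
  let ?P = "{J. ideal J R \<and> I \<subseteq> J \<and> \<one> \<notin> J}"
  have "\<exists>M\<in>?P. \<forall>X\<in>?P. M \<subseteq> X \<longrightarrow> X = M"
  proof (rule subset_Zorn_nonempty)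
    show "?P \<noteq> {}" using I one by blast
    fix C assume C: "C \<noteq> {}" "subset.chain ?P C"
    have CP: "\<And>J. J \<in> C \<Longrightarrow> ideal J R \<and> I \<subseteq> J \<and> \<one> \<notin> J"
      using C(2) by (auto simp: subset.chain_def)
    have tot: "\<And>J K. J \<in> C \<Longrightarrow> K \<in> C \<Longrightarrow> J \<subseteq> K \<or> K \<subseteq> J"
      using C(2) by (auto simp: subset.chain_def)
    have "ideal (\<Union>C) R"
    proof (rule idealI)
      show "ring R" by (rule ring_axioms)
      show "subgroup (\<Union>C) (add_monoid R)"
      proof (rule add.subgroupI)
        show "\<Union>C \<subseteq> carrier R" using CP ideal.Icarr[of _ R] by (meson Union_iff subsetI)
        obtain J where J: "J \<in> C" using C(1) by blast
        have "\<zero> \<in> J" using CP[OF J] by (simp add: additive_subgroup.zero_closed ideal.axioms(1))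
        then show "\<Union>C \<noteq> {}" using J by blast
      next
        fix a assume "a \<in> \<Union>C"
        then obtain J where J: "J \<in> C" "a \<in> J" by blast
        have "\<ominus> a \<in> J" using CP[OF J(1)] J(2)
          by (simp add: additive_subgroup.a_inv_closed ideal.axioms(1))
        then show "\<ominus> a \<in> \<Union>C" using J by blast
      next
        fix a b assume "a \<in> \<Union>C" "b \<in> \<Union>C"
        then obtain J K where JK: "J \<in> C" "a \<in> J" "K \<in> C" "b \<in> K" by blast
        then obtain L where L: "L \<in> C" "a \<in> L" "b \<in> L" using tot[of J K] by blast
        have "a \<oplus> b \<in> L" using CP[OF L(1)] L
          by (simp add: additive_subgroup.a_closed ideal.axioms(1))
        then show "a \<oplus> b \<in> \<Union>C" using L by blast
      qed
    next
      fix a x assume "a \<in> \<Union>C" and x: "x \<in> carrier R"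
      then obtain J where J: "J \<in> C" "a \<in> J" by blast
      interpret J: ideal J R using CP[OF J(1)] by blast
      show "x \<otimes> a \<in> \<Union>C" "a \<otimes> x \<in> \<Union>C"
        using J J.I_l_closed[OF J(2) x] J.I_r_closed[OF J(2) x] by blast+
    qed
    moreover have "I \<subseteq> \<Union>C" using C(1) CP by (meson Union_upper ex_in_conv order_trans)
    moreover have "\<one> \<notin> \<Union>C" using CP by (meson Union_iff)
    ultimately show "\<Union>C \<in> ?P" by simp
  qed
  then obtain M where M: "ideal M R" "I \<subseteq> M" "\<one> \<notin> M"
    and max: "\<And>X. ideal X R \<Longrightarrow> I \<subseteq> X \<Longrightarrow> \<one> \<notin> X \<Longrightarrow> M \<subseteq> X \<Longrightarrow> X = M"
    unfolding Bex_def Ball_def mem_Collect_eq by metis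
  have "maximalideal M R"
  proof (rule maximalidealI)
    show "ideal M R" by fact
    show "carrier R \<noteq> M" using M(3) by blast
    show "J = M \<or> J = carrier R" if "ideal J R" "M \<subseteq> J" for J
      using max[of J] that M(2) ideal.one_imp_carrier[of J R] by (meson order_trans)
  qed
  then show ?thesis using M(2) by blast
qed

lemma (in cring) nonunit_in_maximalideal:
  assumes x: "x \<in> carrier R" "x \<notin> Units R"
  shows "\<exists>M. maximalideal M R \<and> x \<in> M"
proof -
  have "\<one> \<notin> PIdl x"
  proof
    assume "\<one> \<in> PIdl x"
    then obtain y where y: "y \<in> carrier R" "\<one> = y \<otimes> x" unfolding cgenideal_def by blast
    then have "x \<otimes> y = \<one>" using x(1) m_comm by simp
    then show False using x y unfolding Units_def by (metis (mono_tags, lifting) mem_Collect_eq)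
  qed
  then show ?thesis
    using exists_maximalideal[OF cgenideal_ideal[OF x(1)]] cgenideal_self[OF x(1)] by blast
qed

text \<open>If \<open>x\<close> and \<open>1 - x\<close> were both non-units, both would lie in the
  only maximal ideal, and with them their sum \<open>\<one>\<close>.\<close>

lemma local_ring_imp_local_cring:
  assumes "local_ring R"
  shows "local_cring R"
proof -
  interpret cring R using assms by (simp add: local_ring_def)
  obtain M where M: "maximalideal M R" and uniq: "\<And>I. maximalideal I R \<Longrightarrow> I = M"
    using assms unfolding local_ring_def by blast
  interpret M: maximalideal M R by (rule M)
  have one: "\<one>\<^bsub>R\<^esub> \<notin> M" using M.I_notcarr M.one_imp_carrier by blast
  show ?thesis
  proof
    show "\<one>\<^bsub>R\<^esub> \<noteq> \<zero>\<^bsub>R\<^esub>" using one M.zero_closed by auto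
    fix x assume x: "x \<in> carrier R"
    show "x \<in> Units R \<or> \<one>\<^bsub>R\<^esub> \<ominus>\<^bsub>R\<^esub> x \<in> Units R"
    proof (rule ccontr)
      assume "\<not> ?thesis"
      then have "x \<in> M" "\<one>\<^bsub>R\<^esub> \<ominus>\<^bsub>R\<^esub> x \<in> M"
        using nonunit_in_maximalideal[of x] nonunit_in_maximalideal[of "\<one>\<^bsub>R\<^esub> \<ominus>\<^bsub>R\<^esub> x"] x uniq
        by auto
      then have "(\<one>\<^bsub>R\<^esub> \<ominus>\<^bsub>R\<^esub> x) \<oplus>\<^bsub>R\<^esub> x \<in> M" by simp
      moreover have "(\<one>\<^bsub>R\<^esub> \<ominus>\<^bsub>R\<^esub> x) \<oplus>\<^bsub>R\<^esub> x = \<one>\<^bsub>R\<^esub>" using x by algebra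
      ultimately show False using one by simp
    qed
  qed
qed

lemma (in local_cring) nonunit_minus:
  assumes "x \<in> carrier R" "x \<notin> Units R"
  shows "\<ominus> x \<notin> Units R"
proof
  assume "\<ominus> x \<in> Units R"
  moreover have "\<ominus> x = x \<otimes> (\<ominus> \<one>)" using assms(1) by algebra
  ultimately show False using unit_factor[of x "\<ominus> \<one>"] assms by simp
qed

text \<open>With \<open>v\<close> the inverse of \<open>x + y\<close>, the elements
  \<open>v x\<close> and \<open>v y\<close> add up to \<open>\<one>\<close>, so one of them, and
  hence \<open>x\<close> or \<open>y\<close>, is a unit.\<close>

lemma (in local_cring) nonunit_add:
  assumes x: "x \<in> carrier R" "x \<notin> Units R" and y: "y \<in> carrier R" "y \<notin> Units R"
  shows "x \<oplus> y \<notin> Units R"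
proof
  assume u: "x \<oplus> y \<in> Units R"
  define v where "v = inv (x \<oplus> y)"
  have v: "v \<in> Units R" "v \<in> carrier R" "v \<otimes> (x \<oplus> y) = \<one>" using u by (auto simp: v_def)
  have "\<one> \<ominus> v \<otimes> x = v \<otimes> (x \<oplus> y) \<ominus> v \<otimes> x" by (simp add: v)
  also have "\<dots> = v \<otimes> y" using x(1) y(1) v(2) by algebra
  finally have "v \<otimes> x \<in> Units R \<or> v \<otimes> y \<in> Units R"
    using unit_or_unit[of "v \<otimes> x"] x v by simp
  then show False using prod_unit_l[OF _ v(1,2)] x y by blast
qed

text \<open>This takes the place of Nakayama's lemma: lifts are determined only up to non-unit
  multiples, which leaves factors of this form to cancel.\<close>

lemma (in local_cring) one_plus_nonunit:
  assumes "x \<in> carrier R" "x \<notin> Units R"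
  shows "\<one> \<oplus> x \<in> Units R"
  using unit_or_unit[of "\<ominus> x"] nonunit_minus[OF assms] assms(1) by (simp add: a_minus_def)

lemma (in cring) unit_mult_eq_zero:
  assumes "u \<in> Units R" "x \<in> carrier R" "u \<otimes> x = \<zero>"
  shows "x = \<zero>"
proof -
  have "x = inv u \<otimes> (u \<otimes> x)" using assms(1,2) by (simp add: m_assoc[symmetric] Units_closed)
  then show ?thesis using assms(1,3) by simp
qed

lemma (in cring) dvd_of_unit_mult:
  assumes "u \<in> Units R" "a \<in> carrier R" "b \<in> carrier R" "b divides u \<otimes> a"
  shows "b divides a"
proof -
  obtain c where c: "c \<in> carrier R" "u \<otimes> a = b \<otimes> c" using assms(4) by (auto simp: factor_def)
  have "a = inv u \<otimes> (u \<otimes> a)" using assms(1,2) by (simp add: m_assoc[symmetric] Units_closed)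
  also have "\<dots> = b \<otimes> (inv u \<otimes> c)" using assms(1,3) c by (simp add: m_lcomm)
  finally show ?thesis using c assms(1) by (auto simp: factor_def)
qed

section \<open>Finitely generated ideals\<close>

lemma (in ideal) finsum_closed_ideal:
  assumes "finite S" "f \<in> S \<rightarrow> I"
  shows "(\<Oplus>s\<in>S. f s) \<in> I"
  using assms
proof (induct S)
  case empty
  then show ?case by simp
next
  case (insert x F)
  then have f: "f x \<in> I" "f \<in> F \<rightarrow> I" by auto
  then have "f \<in> F \<rightarrow> carrier R" "f x \<in> carrier R" by (auto simp: Pi_iff intro: Icarr)
  then show ?case using insert.hyps f by (simp add: finsum_insert)
qed

text \<open>\<open>h\<close> stays arbitrary because the lemma serves both the generators themselves
  and their images under a map that is to be lifted.\<close>

lemma (in cring) finsum_coeff_add: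
  assumes "finite S" "r \<in> S \<rightarrow> carrier R" "q \<in> S \<rightarrow> carrier R" "h \<in> S \<rightarrow> carrier R"
  shows "(\<Oplus>s\<in>S. (r s \<oplus> q s) \<otimes> h s) = (\<Oplus>s\<in>S. r s \<otimes> h s) \<oplus> (\<Oplus>s\<in>S. q s \<otimes> h s)"
proof -
  have "(\<Oplus>s\<in>S. (r s \<oplus> q s) \<otimes> h s) = (\<Oplus>s\<in>S. r s \<otimes> h s \<oplus> q s \<otimes> h s)"
    using assms by (intro finsum_cong') (auto simp: l_distr Pi_iff)
  also have "\<dots> = (\<Oplus>s\<in>S. r s \<otimes> h s) \<oplus> (\<Oplus>s\<in>S. q s \<otimes> h s)"
    using assms by (intro finsum_addf) (auto simp: Pi_iff)
  finally show ?thesis .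
qed

lemma (in cring) finsum_coeff_mult:
  assumes "finite S" "r \<in> S \<rightarrow> carrier R" "x \<in> carrier R" "h \<in> S \<rightarrow> carrier R"
  shows "(\<Oplus>s\<in>S. (x \<otimes> r s) \<otimes> h s) = x \<otimes> (\<Oplus>s\<in>S. r s \<otimes> h s)"
proof -
  have "(\<Oplus>s\<in>S. (x \<otimes> r s) \<otimes> h s) = (\<Oplus>s\<in>S. x \<otimes> (r s \<otimes> h s))"
    using assms by (intro finsum_cong') (auto simp: m_assoc Pi_iff)
  also have "\<dots> = x \<otimes> (\<Oplus>s\<in>S. r s \<otimes> h s)"
    using assms by (subst finsum_rdistr) (auto simp: Pi_iff)
  finally show ?thesis .
qed

text \<open>The combinations form an ideal, which contains \<open>S\<close> by Kronecker delta
  coefficients; minimality of \<open>Idl S\<close> does the rest.\<close>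

lemma (in cring) Idl_finite:
  assumes S: "finite S" "S \<subseteq> carrier R"
  shows "Idl S = {\<Oplus>s\<in>S. r s \<otimes> s | r. r \<in> S \<rightarrow> carrier R}" (is "_ = ?L")
proof
  have cl: "(\<lambda>s. r s \<otimes> s) \<in> S \<rightarrow> carrier R" if "r \<in> S \<rightarrow> carrier R" for r
    using that S by auto
  interpret I: ideal "Idl S" R by (rule genideal_ideal[OF S(2)])
  show "?L \<subseteq> Idl S"
  proof
    fix x assume "x \<in> ?L"
    then obtain r where r: "r \<in> S \<rightarrow> carrier R" "x = (\<Oplus>s\<in>S. r s \<otimes> s)" by blast
    have "(\<lambda>s. r s \<otimes> s) \<in> S \<rightarrow> Idl S"
      using r(1) genideal_self[OF S(2)] I.I_l_closed by (simp add: Pi_iff subset_iff)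
    then show "x \<in> Idl S" using I.finsum_closed_ideal[OF S(1)] r(2) by simp
  qed
  have "ideal ?L R"
  proof (rule idealI)
    show "ring R" by (rule ring_axioms)
    show "subgroup ?L (add_monoid R)"
    proof (rule add.subgroupI)
      show "?L \<subseteq> carrier R" using cl by (auto simp only: intro!: finsum_closed)
      have "(\<Oplus>s\<in>S. \<zero> \<otimes> s) \<in> ?L"
        by (rule CollectI, rule exI[of _ "\<lambda>_. \<zero>"]) simp
      then show "?L \<noteq> {}" by blast
    next
      fix a assume "a \<in> ?L"
      then obtain r where r: "r \<in> S \<rightarrow> carrier R" "a = (\<Oplus>s\<in>S. r s \<otimes> s)" by blast
      have "\<ominus> a = (\<ominus> \<one>) \<otimes> a" using r cl[OF r(1)] finsum_closed by (simp add: l_minus)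
      also have "\<dots> = (\<Oplus>s\<in>S. (\<ominus> \<one> \<otimes> r s) \<otimes> s)"
        unfolding r(2) using r(1) S by (intro finsum_coeff_mult[symmetric]) auto
      finally show "\<ominus> a \<in> ?L"
        using r(1) by (auto intro!: exI[of _ "\<lambda>s. \<ominus> \<one> \<otimes> r s"])
    next
      fix a b assume "a \<in> ?L" "b \<in> ?L"
      then obtain r q where r: "r \<in> S \<rightarrow> carrier R" "a = (\<Oplus>s\<in>S. r s \<otimes> s)"
        and q: "q \<in> S \<rightarrow> carrier R" "b = (\<Oplus>s\<in>S. q s \<otimes> s)" by blast
      have "a \<oplus> b = (\<Oplus>s\<in>S. (r s \<oplus> q s) \<otimes> s)"
        unfolding r(2) q(2) using r(1) q(1) S by (intro finsum_coeff_add[symmetric]) auto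
      then show "a \<oplus> b \<in> ?L"
        using r q by (auto intro!: exI[of _ "\<lambda>s. r s \<oplus> q s"])
    qed
    fix a x assume a: "a \<in> ?L" and x: "x \<in> carrier R"
    then obtain r where r: "r \<in> S \<rightarrow> carrier R" "a = (\<Oplus>s\<in>S. r s \<otimes> s)" by blast
    have "x \<otimes> a = (\<Oplus>s\<in>S. (x \<otimes> r s) \<otimes> s)"
      unfolding r(2) using r(1) S x by (intro finsum_coeff_mult[symmetric]) auto
    then show xa: "x \<otimes> a \<in> ?L"
      using r x by (auto intro!: exI[of _ "\<lambda>s. x \<otimes> r s"])
    have "a \<in> carrier R" using r cl[OF r(1)] by (simp add: finsum_closed)
    then show "a \<otimes> x \<in> ?L" using xa x by (simp add: m_comm)
  qed
  moreover have "S \<subseteq> ?L"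
  proof
    fix t assume t: "t \<in> S"
    have "(\<Oplus>s\<in>S. (if t = s then \<one> else \<zero>) \<otimes> s) = (\<Oplus>s\<in>S. if t = s then s else \<zero>)"
      using S by (intro finsum_cong') auto
    also have "\<dots> = t" using t S by (intro finsum_singleton) auto
    finally show "t \<in> ?L" by (auto intro!: exI[of _ "\<lambda>s. if t = s then \<one> else \<zero>"])
  qed
  ultimately show "Idl S \<subseteq> ?L" by (rule genideal_minimal)
qed

lemma (in cring) annihilator_ideal:
  assumes c: "c \<in> carrier R"
  shows "ideal {v \<in> carrier R. c \<otimes> v = \<zero>} R"
proof (rule idealI)
  show "ring R" by (rule ring_axioms)
  show "subgroup {v \<in> carrier R. c \<otimes> v = \<zero>} (add_monoid R)"
    using c by (intro add.subgroupI) (auto simp: r_distr r_minus)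
  show "x \<otimes> a \<in> {v \<in> carrier R. c \<otimes> v = \<zero>}"
    if "a \<in> {v \<in> carrier R. c \<otimes> v = \<zero>}" "x \<in> carrier R" for a x
    using that c m_lcomm[of c x a] by simp
  then show "a \<otimes> x \<in> {v \<in> carrier R. c \<otimes> v = \<zero>}"
    if "a \<in> {v \<in> carrier R. c \<otimes> v = \<zero>}" "x \<in> carrier R" for a x
    using that by (simp add: m_comm)
qed

text \<open>Applied to an annihilator, this yields the ideal \<open>ann(a) b\<close>, modulo which
  the annihilators of incomparable elements are compared below.\<close>

lemma (in cring) image_mult_ideal:
  assumes I: "ideal I R" and b: "b \<in> carrier R"
  shows "ideal ((\<lambda>t. t \<otimes> b) ` I) R"
proof (rule idealI)
  interpret I: ideal I R by (rule I)
  show "ring R" by (rule ring_axioms)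
  show "subgroup ((\<lambda>t. t \<otimes> b) ` I) (add_monoid R)"
  proof (rule add.subgroupI)
    show "(\<lambda>t. t \<otimes> b) ` I \<subseteq> carrier R" using b I.Icarr by auto
    show "(\<lambda>t. t \<otimes> b) ` I \<noteq> {}" using I.zero_closed by blast
  next
    fix a assume "a \<in> (\<lambda>t. t \<otimes> b) ` I"
    then obtain t where t: "t \<in> I" "a = t \<otimes> b" by blast
    then have "\<ominus> a = (\<ominus> t) \<otimes> b" using b I.Icarr by (simp add: l_minus)
    then show "\<ominus> a \<in> (\<lambda>t. t \<otimes> b) ` I" using I.a_inv_closed[OF t(1)] by blast
  next
    fix x y assume "x \<in> (\<lambda>t. t \<otimes> b) ` I" "y \<in> (\<lambda>t. t \<otimes> b) ` I"
    then obtain t u where t: "t \<in> I" "x = t \<otimes> b" "u \<in> I" "y = u \<otimes> b" by blast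
    then have "x \<oplus> y = (t \<oplus> u) \<otimes> b" using b I.Icarr by (simp add: l_distr)
    then show "x \<oplus> y \<in> (\<lambda>t. t \<otimes> b) ` I" using I.a_closed t by blast
  qed
  fix a x assume "a \<in> (\<lambda>t. t \<otimes> b) ` I" and x: "x \<in> carrier R"
  then obtain t where t: "t \<in> I" "a = t \<otimes> b" by blast
  then have xa: "x \<otimes> a = (x \<otimes> t) \<otimes> b" and a: "a \<in> carrier R" using b x I.Icarr by (simp_all add: m_assoc)
  then show "x \<otimes> a \<in> (\<lambda>t. t \<otimes> b) ` I" using I.I_l_closed[OF t(1) x] by blast
  then show "a \<otimes> x \<in> (\<lambda>t. t \<otimes> b) ` I" using m_comm[OF a x] by simp
qed

lemma (in cring) Idl_pair:
  assumes ab: "a \<in> carrier R" "b \<in> carrier R"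
  shows "v \<in> Idl {a, b} \<longleftrightarrow> (\<exists>r\<in>carrier R. \<exists>s\<in>carrier R. v = r \<otimes> a \<oplus> s \<otimes> b)"
proof
  assume "v \<in> Idl {a, b}"
  then obtain r where r: "r \<in> {a, b} \<rightarrow> carrier R" "v = (\<Oplus>s\<in>{a, b}. r s \<otimes> s)"
    using Idl_finite[of "{a, b}"] ab by auto
  show "\<exists>r\<in>carrier R. \<exists>s\<in>carrier R. v = r \<otimes> a \<oplus> s \<otimes> b"
  proof (cases "a = b")
    case True
    \<comment> \<open>The sum over \<open>{a, b}\<close> has a single term here, so the coefficient
      of \<open>b\<close> is set to \<open>\<zero>\<close>.\<close>
    then have "v = r a \<otimes> a \<oplus> \<zero> \<otimes> b" using r ab by simp
    then show ?thesis using r(1) by blast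
  next
    case False
    then have "v = r a \<otimes> a \<oplus> r b \<otimes> b" using r ab by simp
    then show ?thesis using r(1) by blast
  qed
next
  assume "\<exists>r\<in>carrier R. \<exists>s\<in>carrier R. v = r \<otimes> a \<oplus> s \<otimes> b"
  moreover interpret I: ideal "Idl {a, b}" R using ab by (intro genideal_ideal) auto
  have "a \<in> Idl {a, b}" "b \<in> Idl {a, b}" using genideal_self[of "{a, b}"] ab by auto
  ultimately show "v \<in> Idl {a, b}" using I.I_l_closed I.a_closed by auto
qed

section \<open>Linear maps on two-generated ideals\<close>

text \<open>Sending the generators to \<open>p\<close> and \<open>q\<close> is well defined modulo
  \<open>X\<close> because \<open>rel\<close> sends every relation into \<open>X\<close>;
  quasi-projectivity then provides the lift.\<close>

lemma (in cring) quasi_projective_pair_map: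
  assumes ab: "a \<in> carrier R" "b \<in> carrier R"
    and qp: "quasi_projective_ideal R (Idl {a, b})"
    and X: "ideal X R" "X \<subseteq> Idl {a, b}"
    and pq: "p \<in> Idl {a, b}" "q \<in> Idl {a, b}"
    and rel: "\<And>r s. r \<in> carrier R \<Longrightarrow> s \<in> carrier R \<Longrightarrow> r \<otimes> a \<oplus> s \<otimes> b = \<zero> \<Longrightarrow> r \<otimes> p \<oplus> s \<otimes> q \<in> X"
  obtains f where "f \<in> Idl {a, b} \<rightarrow> Idl {a, b}" "lin_on R (Idl {a, b}) f"
    "f a \<ominus> p \<in> X" "f b \<ominus> q \<in> X"
proof -
  let ?I = "Idl {a, b}"
  interpret I: ideal ?I R using ab by (intro genideal_ideal) auto
  interpret X: ideal X R by (rule X)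
  have abI: "a \<in> ?I" "b \<in> ?I" using genideal_self[of "{a, b}"] ab by auto
  \<comment> \<open>Coefficients are chosen arbitrarily for each \<open>v\<close>, so the resulting
    \<open>g\<close> is linear only modulo \<open>X\<close>.\<close>
  have "\<forall>v\<in>?I. \<exists>rs. fst rs \<in> carrier R \<and> snd rs \<in> carrier R \<and> v = fst rs \<otimes> a \<oplus> snd rs \<otimes> b"
    using Idl_pair[OF ab] by auto
  then obtain \<gamma> where \<gamma>: "\<And>v. v \<in> ?I \<Longrightarrow> fst (\<gamma> v) \<in> carrier R \<and> snd (\<gamma> v) \<in> carrier R \<and>
      v = fst (\<gamma> v) \<otimes> a \<oplus> snd (\<gamma> v) \<otimes> b"
    by (metis (no_types, lifting))
  define \<rho> where "\<rho> v = fst (\<gamma> v)" for v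
  define \<sigma> where "\<sigma> v = snd (\<gamma> v)" for v
  have \<rho>: "\<rho> v \<in> carrier R" and \<sigma>: "\<sigma> v \<in> carrier R" and \<rho>\<sigma>: "\<rho> v \<otimes> a \<oplus> \<sigma> v \<otimes> b = v"
    if "v \<in> ?I" for v
    using \<gamma>[OF that] unfolding \<rho>_def \<sigma>_def by simp_all
  define g where "g v = \<rho> v \<otimes> p \<oplus> \<sigma> v \<otimes> q" for v
  have pqc: "p \<in> carrier R" "q \<in> carrier R" using pq I.Icarr by auto
  have gI: "g v \<in> ?I" if "v \<in> ?I" for v
    using that \<rho> \<sigma> pq I.I_l_closed I.a_closed by (simp add: g_def)
  \<comment> \<open>Two expressions of the same element differ by a relation, so by
    \<open>rel\<close> the value of \<open>g\<close> changes only within \<open>X\<close>.\<close>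
  have key: "g (r \<otimes> a \<oplus> s \<otimes> b) \<ominus> (r \<otimes> p \<oplus> s \<otimes> q) \<in> X" if rs: "r \<in> carrier R" "s \<in> carrier R" for r s
  proof -
    let ?v = "r \<otimes> a \<oplus> s \<otimes> b"
    have v: "?v \<in> ?I" using rs abI I.I_l_closed I.a_closed by simp
    note c = \<rho>[OF v] \<sigma>[OF v] rs ab pqc
    have "(\<rho> ?v \<ominus> r) \<otimes> a \<oplus> (\<sigma> ?v \<ominus> s) \<otimes> b = (\<rho> ?v \<otimes> a \<oplus> \<sigma> ?v \<otimes> b) \<ominus> ?v" using c by algebra
    also have "\<dots> = ?v \<ominus> ?v" by (simp only: \<rho>\<sigma>[OF v])
    also have "\<dots> = \<zero>" using rs ab by (simp add: a_minus_def r_neg)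
    finally have "(\<rho> ?v \<ominus> r) \<otimes> p \<oplus> (\<sigma> ?v \<ominus> s) \<otimes> q \<in> X" using c by (intro rel) auto
    also have "(\<rho> ?v \<ominus> r) \<otimes> p \<oplus> (\<sigma> ?v \<ominus> s) \<otimes> q = g ?v \<ominus> (r \<otimes> p \<oplus> s \<otimes> q)"
      unfolding g_def using c by algebra
    finally show ?thesis .
  qed
  have "lin_mod_on R ?I X g"
    unfolding lin_mod_on_def
  proof (intro conjI ballI)
    fix x y assume x: "x \<in> ?I" and y: "y \<in> ?I"
    note c = \<rho>[OF x] \<sigma>[OF x] \<rho>[OF y] \<sigma>[OF y] ab pqc
    have xy: "x \<oplus> y = (\<rho> x \<oplus> \<rho> y) \<otimes> a \<oplus> (\<sigma> x \<oplus> \<sigma> y) \<otimes> b"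
    proof -
      have "x \<oplus> y = (\<rho> x \<otimes> a \<oplus> \<sigma> x \<otimes> b) \<oplus> (\<rho> y \<otimes> a \<oplus> \<sigma> y \<otimes> b)" by (simp only: \<rho>\<sigma>[OF x] \<rho>\<sigma>[OF y])
      then show ?thesis using c by algebra
    qed
    have "g x \<oplus> g y = (\<rho> x \<oplus> \<rho> y) \<otimes> p \<oplus> (\<sigma> x \<oplus> \<sigma> y) \<otimes> q" unfolding g_def using c by algebra
    then show "g (x \<oplus> y) \<ominus> (g x \<oplus> g y) \<in> X"
      using key[of "\<rho> x \<oplus> \<rho> y" "\<sigma> x \<oplus> \<sigma> y"] c xy by simp
  next
    fix r x assume r: "r \<in> carrier R" and x: "x \<in> ?I"
    note c = \<rho>[OF x] \<sigma>[OF x] r ab pqc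
    have rx: "r \<otimes> x = (r \<otimes> \<rho> x) \<otimes> a \<oplus> (r \<otimes> \<sigma> x) \<otimes> b"
    proof -
      have "r \<otimes> x = r \<otimes> (\<rho> x \<otimes> a \<oplus> \<sigma> x \<otimes> b)" by (simp only: \<rho>\<sigma>[OF x])
      then show ?thesis using c by algebra
    qed
    have "r \<otimes> g x = (r \<otimes> \<rho> x) \<otimes> p \<oplus> (r \<otimes> \<sigma> x) \<otimes> q" unfolding g_def using c by algebra
    then show "g (r \<otimes> x) \<ominus> (r \<otimes> g x) \<in> X"
      using key[of "r \<otimes> \<rho> x" "r \<otimes> \<sigma> x"] c rx by simp
  qed
  moreover have "g \<in> ?I \<rightarrow> ?I" using gI by (rule Pi_I)
  ultimately have "\<exists>f. f \<in> ?I \<rightarrow> ?I \<and> lin_on R ?I f \<and> (\<forall>v\<in>?I. f v \<ominus> g v \<in> X)"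
    using qp X unfolding quasi_projective_ideal_def ideal_M_projective_def by metis
  then obtain f where f: "f \<in> ?I \<rightarrow> ?I" "lin_on R ?I f" "\<And>v. v \<in> ?I \<Longrightarrow> f v \<ominus> g v \<in> X"
    by (elim exE conjE) simp
  have fab: "f a \<in> carrier R" "f b \<in> carrier R" "g a \<in> carrier R" "g b \<in> carrier R"
    using Pi_mem[OF f(1) abI(1)] Pi_mem[OF f(1) abI(2)] gI[OF abI(1)] gI[OF abI(2)] I.Icarr by simp_all
  have "f a \<ominus> p = (f a \<ominus> g a) \<oplus> (g a \<ominus> p)" using fab pqc by algebra
  moreover have "g a \<ominus> p \<in> X" using key[of \<one> \<zero>] ab pqc by simp
  ultimately have 1: "f a \<ominus> p \<in> X" using f(3)[OF abI(1)] by simp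
  have "f b \<ominus> q = (f b \<ominus> g b) \<oplus> (g b \<ominus> q)" using fab pqc by algebra
  moreover have "g b \<ominus> q \<in> X" using key[of \<zero> \<one>] ab pqc by simp
  ultimately have "f b \<ominus> q \<in> X" using f(3)[OF abI(2)] by simp
  with f 1 that show thesis by blast
qed

section \<open>Quasi-projective ideals in local rings\<close>

text \<open>Equivalently, the sum \<open>Ra + Rb\<close> is direct and \<open>a\<close> and
  \<open>b\<close> have the same annihilator; a single condition on relations covers both.\<close>

definition indep_pair :: "('a, 'c) ring_scheme \<Rightarrow> 'a \<Rightarrow> 'a \<Rightarrow> bool" where
  "indep_pair R a b \<longleftrightarrow> (\<forall>r\<in>carrier R. \<forall>s\<in>carrier R.
     r \<otimes>\<^bsub>R\<^esub> a \<oplus>\<^bsub>R\<^esub> s \<otimes>\<^bsub>R\<^esub> b = \<zero>\<^bsub>R\<^esub> \<longrightarrow>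
     r \<otimes>\<^bsub>R\<^esub> a = \<zero>\<^bsub>R\<^esub> \<and> r \<otimes>\<^bsub>R\<^esub> b = \<zero>\<^bsub>R\<^esub> \<and>
     s \<otimes>\<^bsub>R\<^esub> a = \<zero>\<^bsub>R\<^esub> \<and> s \<otimes>\<^bsub>R\<^esub> b = \<zero>\<^bsub>R\<^esub>)"

definition chained_or_indep :: "('a, 'c) ring_scheme \<Rightarrow> bool" where
  "chained_or_indep R \<longleftrightarrow> (\<forall>a\<in>carrier R. \<forall>b\<in>carrier R.
     a divides\<^bsub>R\<^esub> b \<or> b divides\<^bsub>R\<^esub> a \<or> indep_pair R a b)"

lemma lin_onD:
  assumes "lin_on R V f"
  shows "x \<in> V \<Longrightarrow> y \<in> V \<Longrightarrow> f (x \<oplus>\<^bsub>R\<^esub> y) = f x \<oplus>\<^bsub>R\<^esub> f y"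
    and "r \<in> carrier R \<Longrightarrow> x \<in> V \<Longrightarrow> f (r \<otimes>\<^bsub>R\<^esub> x) = r \<otimes>\<^bsub>R\<^esub> f x"
  using assms unfolding lin_on_def by blast+

lemma (in cring) lin_on_zero:
  assumes "lin_on R V f" "f \<in> V \<rightarrow> carrier R" "V \<subseteq> carrier R" "v \<in> V"
  shows "f \<zero> = \<zero>"
proof -
  have "f (\<zero> \<otimes> v) = \<zero> \<otimes> f v" using lin_onD(2)[OF assms(1) zero_closed assms(4)] .
  then show ?thesis using Pi_mem[OF assms(2,4)] assms(3,4) by auto
qed

text \<open>The lift satisfies \<open>f a = (1 + t) a\<close> and \<open>f b = q b\<close>, where
  incomparability makes \<open>t\<close> and \<open>q\<close> non-units. Applying \<open>f\<close>
  to the relation gives \<open>(1 + t - q) r a = 0\<close>, and the first factor is a unit.\<close>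

lemma (in local_cring) relation_zero_of_incomparable:
  assumes ab: "a \<in> carrier R" "b \<in> carrier R"
    and qp: "quasi_projective_ideal R (Idl {a, b})"
    and nd: "\<not> a divides b" "\<not> b divides a"
    and rs: "r \<in> carrier R" "s \<in> carrier R" "r \<otimes> a \<oplus> s \<otimes> b = \<zero>"
  shows "r \<otimes> a = \<zero>"
proof -
  let ?I = "Idl {a, b}"
  interpret I: ideal ?I R using ab by (intro genideal_ideal) auto
  have abI: "a \<in> ?I" "b \<in> ?I" using genideal_self[of "{a, b}"] ab by auto
  \<comment> \<open>Modulo \<open>aR \<inter> bR\<close> the sum \<open>aR + bR\<close> is direct, so the projection to \<open>aR\<close> is a linear map
    that can be lifted.\<close>
  let ?X = "PIdl a \<inter> PIdl b"
  have X: "ideal ?X R" using ab by (intro i_intersect cgenideal_ideal)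
  have XI: "?X \<subseteq> ?I" using cgenideal_minimal[OF I.is_ideal abI(1)] by blast
  have rel: "r' \<otimes> a \<oplus> s' \<otimes> \<zero> \<in> ?X"
    if "r' \<in> carrier R" "s' \<in> carrier R" "r' \<otimes> a \<oplus> s' \<otimes> b = \<zero>" for r' s'
  proof -
    have "r' \<otimes> a = (r' \<otimes> a \<oplus> s' \<otimes> b) \<ominus> s' \<otimes> b" using that(1,2) ab by algebra
    also have "\<dots> = (\<ominus> s') \<otimes> b" using that ab by (simp add: a_minus_def l_minus)
    finally have "r' \<otimes> a \<in> PIdl b" unfolding cgenideal_def using that(2) a_inv_closed by blast
    moreover have "r' \<otimes> a \<in> PIdl a" unfolding cgenideal_def using that(1) by blast
    ultimately show ?thesis using that ab by simp
  qed
  obtain f where f: "f \<in> ?I \<rightarrow> ?I" "lin_on R ?I f" "f a \<ominus> a \<in> ?X" "f b \<ominus> \<zero> \<in> ?X"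
    by (rule quasi_projective_pair_map[OF ab qp X XI abI(1) I.zero_closed rel])
  have fab: "f a \<in> carrier R" "f b \<in> carrier R" using f(1) abI I.Icarr by (meson Pi_mem)+
  obtain t t' where t: "t \<in> carrier R" "f a \<ominus> a = t \<otimes> a" "t' \<in> carrier R" "f a \<ominus> a = t' \<otimes> b"
    using f(3) unfolding cgenideal_def by blast
  have "f b \<in> ?X" using f(4) fab by (simp add: a_minus_def)
  then obtain q q' where q: "q \<in> carrier R" "f b = q \<otimes> b" "q' \<in> carrier R" "f b = q' \<otimes> a"
    unfolding cgenideal_def by blast
  \<comment> \<open>\<open>t a\<close> is also a multiple of \<open>b\<close>, so a unit
    \<open>t\<close> would make \<open>b\<close> divide \<open>a\<close>.\<close>
  have tn: "t \<notin> Units R"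
  proof
    assume "t \<in> Units R"
    moreover have "t \<otimes> a = b \<otimes> t'" using t ab m_comm by simp
    then have "b divides t \<otimes> a" using t(3) by (auto simp: factor_def)
    ultimately show False using dvd_of_unit_mult ab nd by blast
  qed
  have qn: "q \<notin> Units R"
  proof
    assume "q \<in> Units R"
    moreover have "q \<otimes> b = a \<otimes> q'" using q ab m_comm by simp
    then have "a divides q \<otimes> b" using q(3) by (auto simp: factor_def)
    ultimately show False using dvd_of_unit_mult ab nd by blast
  qed
  have "\<one> \<oplus> (t \<oplus> \<ominus> q) \<in> Units R"
    using t q tn qn nonunit_minus nonunit_add one_plus_nonunit by simp
  moreover have "(\<one> \<oplus> (t \<oplus> \<ominus> q)) \<otimes> (r \<otimes> a) = \<zero>"
  proof -
    have fa: "f a = a \<oplus> t \<otimes> a" using t(2)[symmetric] fab ab by algebra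
    have "f (r \<otimes> a \<oplus> s \<otimes> b) = r \<otimes> f a \<oplus> s \<otimes> f b"
      using lin_onD[OF f(2)] abI rs(1,2) I.I_l_closed by simp
    also have "f (r \<otimes> a \<oplus> s \<otimes> b) = \<zero>"
      using lin_on_zero[OF f(2) _ _ abI(1)] f(1) rs(3) I.Icarr by (simp add: Pi_iff subset_iff)
    finally have "r \<otimes> f a \<oplus> s \<otimes> f b = \<zero>" by simp
    then have "r \<otimes> (a \<oplus> t \<otimes> a) \<oplus> s \<otimes> (q \<otimes> b) = \<zero>" using fa q(2) by simp
    \<comment> \<open>Subtracting \<open>q\<close> times the relation cancels \<open>q s b\<close>
      at the price of \<open>- q r a\<close>.\<close>
    moreover have "(\<one> \<oplus> (t \<oplus> \<ominus> q)) \<otimes> (r \<otimes> a) =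
        (r \<otimes> (a \<oplus> t \<otimes> a) \<oplus> s \<otimes> (q \<otimes> b)) \<ominus> q \<otimes> (r \<otimes> a \<oplus> s \<otimes> b)"
      using rs(1,2) t(1) q(1) ab by algebra
    ultimately show ?thesis using rs(3) q(1) by (simp add: a_minus_def)
  qed
  ultimately show ?thesis using unit_mult_eq_zero rs(1) ab by simp
qed

text \<open>The lift has \<open>f a = (1 + t) b\<close> with \<open>t a = 0\<close>; a unit
  \<open>t\<close> would give \<open>a = 0\<close>, a multiple of \<open>b\<close>. Hence
  \<open>(1 + t) r b = f (r a) = 0\<close> can be cancelled.\<close>

lemma (in local_cring) annihilator_le_of_incomparable:
  assumes ab: "a \<in> carrier R" "b \<in> carrier R"
    and qp: "quasi_projective_ideal R (Idl {a, b})"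
    and nd: "\<not> a divides b" "\<not> b divides a"
    and r: "r \<in> carrier R" "r \<otimes> a = \<zero>"
  shows "r \<otimes> b = \<zero>"
proof -
  let ?I = "Idl {a, b}"
  interpret I: ideal ?I R using ab by (intro genideal_ideal) auto
  have abI: "a \<in> ?I" "b \<in> ?I" using genideal_self[of "{a, b}"] ab by auto
  \<comment> \<open>The sum \<open>aR + bR\<close> is now known to be direct, and \<open>a \<mapsto> b\<close> is well defined modulo
    \<open>ann(a) b\<close>.\<close>
  let ?N = "{t \<in> carrier R. a \<otimes> t = \<zero>}"
  let ?X = "(\<lambda>t. t \<otimes> b) ` ?N"
  have X: "ideal ?X R" using ab by (intro image_mult_ideal annihilator_ideal)
  have XI: "?X \<subseteq> ?I" using I.I_l_closed abI by auto
  have rel: "r' \<otimes> b \<oplus> s' \<otimes> \<zero> \<in> ?X"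
    if "r' \<in> carrier R" "s' \<in> carrier R" "r' \<otimes> a \<oplus> s' \<otimes> b = \<zero>" for r' s'
  proof -
    have "a \<otimes> r' = \<zero>"
      using relation_zero_of_incomparable[OF ab qp nd that] m_comm[OF ab(1) that(1)] by simp
    then show ?thesis using that(1,2) ab by simp
  qed
  obtain f where f: "f \<in> ?I \<rightarrow> ?I" "lin_on R ?I f" "f a \<ominus> b \<in> ?X"
    by (rule quasi_projective_pair_map[OF ab qp X XI abI(2) I.zero_closed rel])
  have fab: "f a \<in> carrier R" using f(1) abI I.Icarr by (meson Pi_mem)
  obtain t where t: "t \<in> carrier R" "a \<otimes> t = \<zero>" "f a \<ominus> b = t \<otimes> b"
    using f(3) by blast
  have tn: "t \<notin> Units R"
  proof
    assume "t \<in> Units R"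
    then have "a = b \<otimes> \<zero>" using unit_mult_eq_zero[of t a] t ab by (simp add: m_comm)
    then show False using nd(2) by (auto simp: factor_def)
  qed
  have fa: "f a = b \<oplus> t \<otimes> b" using t(3)[symmetric] fab ab by algebra
  have "r \<otimes> f a = f (r \<otimes> a)" using lin_onD(2)[OF f(2) r(1) abI(1)] by simp
  also have "\<dots> = \<zero>"
    using lin_on_zero[OF f(2) _ _ abI(1)] f(1) r(2) I.Icarr by (simp add: Pi_iff subset_iff)
  finally have "r \<otimes> (b \<oplus> t \<otimes> b) = \<zero>" using fa by simp
  moreover have "(\<one> \<oplus> t) \<otimes> (r \<otimes> b) = r \<otimes> (b \<oplus> t \<otimes> b)" using r t(1) ab by algebra
  ultimately show ?thesis using unit_mult_eq_zero[OF one_plus_nonunit[OF t(1) tn]] r(1) ab by simp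
qed

text \<open>Incomparability is symmetric, so the two preceding lemmas also apply with
  \<open>a\<close> and \<open>b\<close> exchanged and together give all four equations.\<close>

lemma (in local_cring) fqp_ring_imp_chained_or_indep:
  assumes "fqp_ring R"
  shows "chained_or_indep R"
proof -
  have "r \<otimes> a = \<zero> \<and> r \<otimes> b = \<zero> \<and> s \<otimes> a = \<zero> \<and> s \<otimes> b = \<zero>"
    if ab: "a \<in> carrier R" "b \<in> carrier R" and nd: "\<not> a divides b" "\<not> b divides a"
      and rs: "r \<in> carrier R" "s \<in> carrier R" "r \<otimes> a \<oplus> s \<otimes> b = \<zero>" for a b r s
  proof -
    have qp: "quasi_projective_ideal R (Idl {a, b})" "quasi_projective_ideal R (Idl {b, a})"
      using assms ab unfolding fqp_ring_def by auto
    have sr: "s \<otimes> b \<oplus> r \<otimes> a = \<zero>" using rs ab by (simp add: a_comm)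
    have ra: "r \<otimes> a = \<zero>" by (rule relation_zero_of_incomparable[OF ab qp(1) nd rs])
    have sb: "s \<otimes> b = \<zero>"
      by (rule relation_zero_of_incomparable[OF ab(2,1) qp(2) nd(2,1) rs(2,1) sr])
    show ?thesis
      using ra sb annihilator_le_of_incomparable[OF ab qp(1) nd rs(1) ra]
        annihilator_le_of_incomparable[OF ab(2,1) qp(2) nd(2,1) rs(2) sb] by simp
  qed
  then show ?thesis unfolding chained_or_indep_def indep_pair_def by blast
qed

section \<open>Ideals with only trivial relations between the generators\<close>

text \<open>The coefficients of a relation annihilate the whole ideal, hence also the values of
  \<open>g\<close>. So \<open>s \<mapsto> g s\<close> extends from \<open>S\<close> to an exactly
  linear map, although \<open>g\<close> is linear only modulo \<open>X\<close>.\<close>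

lemma (in cring) quasi_projective_if_relations_trivial:
  assumes S: "finite S" "S \<subseteq> carrier R"
    and triv: "\<And>r s t. r \<in> S \<rightarrow> carrier R \<Longrightarrow> (\<Oplus>s\<in>S. r s \<otimes> s) = \<zero> \<Longrightarrow> s \<in> S \<Longrightarrow> t \<in> S \<Longrightarrow>
      r s \<otimes> t = \<zero>"
  shows "quasi_projective_ideal R (Idl S)"
  unfolding quasi_projective_ideal_def ideal_M_projective_def
proof (intro allI impI)
  fix X g
  assume X: "ideal X R" and XI: "X \<subseteq> Idl S" and g: "g \<in> Idl S \<rightarrow> Idl S"
    and lin: "lin_mod_on R (Idl S) X g"
  interpret I: ideal "Idl S" R by (rule genideal_ideal[OF S(2)])
  interpret X: ideal X R by (rule X)
  have SI: "S \<subseteq> Idl S" by (rule genideal_self[OF S(2)])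
  have gI: "g v \<in> Idl S" "g v \<in> carrier R" if "v \<in> Idl S" for v
    using Pi_mem[OF g that] I.Icarr by auto
  have gS: "g \<in> S \<rightarrow> carrier R" using gI SI by auto
  have idS: "(\<lambda>s. s) \<in> S \<rightarrow> carrier R" using S by auto
  have "\<forall>v\<in>Idl S. \<exists>r. r \<in> S \<rightarrow> carrier R \<and> v = (\<Oplus>s\<in>S. r s \<otimes> s)"
    using Idl_finite[OF S] by blast
  then obtain \<kappa> where \<kappa>: "\<And>v. v \<in> Idl S \<Longrightarrow> \<kappa> v \<in> S \<rightarrow> carrier R \<and> v = (\<Oplus>s\<in>S. \<kappa> v s \<otimes> s)"
    by metis
  define f where "f v = (\<Oplus>s\<in>S. \<kappa> v s \<otimes> g s)" for v
  \<comment> \<open>The value of \<open>f\<close> does not depend on the chosen coefficients,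
    exactly and not only modulo \<open>X\<close>; additivity and homogeneity of \<open>f\<close>
    rest on this.\<close>
  have key: "f v = (\<Oplus>s\<in>S. r s \<otimes> g s)"
    if v: "v \<in> Idl S" and r: "r \<in> S \<rightarrow> carrier R" "v = (\<Oplus>s\<in>S. r s \<otimes> s)" for v r
  proof -
    have k: "\<kappa> v \<in> S \<rightarrow> carrier R" "(\<Oplus>s\<in>S. \<kappa> v s \<otimes> s) = v" using \<kappa>[OF v] by auto
    let ?m = "\<lambda>s. \<ominus> \<one> \<otimes> r s"
    have m: "?m \<in> S \<rightarrow> carrier R" using r by auto
    have vc: "v \<in> carrier R" using v I.Icarr by blast
    have "(\<Oplus>s\<in>S. (\<kappa> v s \<oplus> ?m s) \<otimes> s) = v \<oplus> (\<ominus> \<one>) \<otimes> v"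
      using finsum_coeff_add[OF S(1) k(1) m idS] finsum_coeff_mult[OF S(1) r(1) _ idS, of "\<ominus> \<one>"]
        k(2) r(2) by simp
    also have "\<dots> = \<zero>" using vc by algebra
    finally have 0: "(\<Oplus>s\<in>S. (\<kappa> v s \<oplus> ?m s) \<otimes> s) = \<zero>" .
    have cm: "(\<lambda>s. \<kappa> v s \<oplus> ?m s) \<in> S \<rightarrow> carrier R" using k m by auto
    have eq: "\<kappa> v s \<otimes> g s = r s \<otimes> g s" if s: "s \<in> S" for s
    proof -
      have c: "\<kappa> v s \<in> carrier R" "r s \<in> carrier R" "g s \<in> carrier R" using k r gS s by auto
      \<comment> \<open>The annihilator of a difference of coefficients is an ideal containing
        \<open>S\<close>, so it also contains \<open>g s\<close>, an element of
        \<open>Idl S\<close>.\<close>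
      have "Idl S \<subseteq> {w \<in> carrier R. (\<kappa> v s \<oplus> ?m s) \<otimes> w = \<zero>}"
        using c S triv[OF cm 0 s] by (intro genideal_minimal annihilator_ideal) auto
      then have "(\<kappa> v s \<oplus> ?m s) \<otimes> g s = \<zero>" using gI(1) SI s by blast
      moreover have "\<kappa> v s \<otimes> g s = (\<kappa> v s \<oplus> ?m s) \<otimes> g s \<oplus> r s \<otimes> g s" using c by algebra
      ultimately show ?thesis using c by simp
    qed
    show ?thesis unfolding f_def using r(1) gS eq by (intro finsum_cong') auto
  qed
  have fcl: "f v \<in> Idl S" if "v \<in> Idl S" for v
    unfolding f_def using \<kappa>[OF that] gI(1) SI I.I_l_closed
    by (intro I.finsum_closed_ideal[OF S(1)]) (auto simp: Pi_iff subset_iff)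
  have add: "f (x \<oplus> y) = f x \<oplus> f y" if x: "x \<in> Idl S" and y: "y \<in> Idl S" for x y
  proof -
    have k: "\<kappa> x \<in> S \<rightarrow> carrier R" "\<kappa> y \<in> S \<rightarrow> carrier R" using \<kappa> x y by auto
    then have "f (x \<oplus> y) = (\<Oplus>s\<in>S. (\<kappa> x s \<oplus> \<kappa> y s) \<otimes> g s)"
      using x y \<kappa> by (intro key) (auto simp: finsum_coeff_add[OF S(1) k idS])
    then show ?thesis unfolding f_def using finsum_coeff_add[OF S(1) k gS] by simp
  qed
  have mul: "f (r \<otimes> x) = r \<otimes> f x" if r: "r \<in> carrier R" and x: "x \<in> Idl S" for r x
  proof -
    have k: "\<kappa> x \<in> S \<rightarrow> carrier R" using \<kappa> x by auto
    then have "f (r \<otimes> x) = (\<Oplus>s\<in>S. (r \<otimes> \<kappa> x s) \<otimes> g s)"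
      using x r \<kappa> I.I_l_closed by (intro key) (auto simp: finsum_coeff_mult[OF S(1) k r idS])
    then show ?thesis unfolding f_def using finsum_coeff_mult[OF S(1) k r gS] by simp
  qed
  have ladd: "g (x \<oplus> y) \<ominus> (g x \<oplus> g y) \<in> X" if "x \<in> Idl S" "y \<in> Idl S" for x y
    using lin that unfolding lin_mod_on_def by blast
  have lmul: "g (r \<otimes> x) \<ominus> r \<otimes> g x \<in> X" if "r \<in> carrier R" "x \<in> Idl S" for r x
    using lin that unfolding lin_mod_on_def by blast
  \<comment> \<open>The errors of \<open>g\<close> add up inside \<open>X\<close> along an induction
    over subsets \<open>T\<close> of \<open>S\<close>; the case \<open>T = S\<close> compares
    \<open>g\<close> with \<open>f\<close>.\<close>
  have part: "g (\<Oplus>s\<in>T. r s \<otimes> s) \<ominus> (\<Oplus>s\<in>T. r s \<otimes> g s) \<in> X"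
    if "finite T" "T \<subseteq> S" and r: "r \<in> S \<rightarrow> carrier R" for T r
    using that(1,2)
  proof (induct T)
    case empty
    then show ?case using lmul[OF zero_closed I.zero_closed] gI[OF I.zero_closed] by simp
  next
    case (insert x T)
    then have TS: "T \<subseteq> S" "x \<in> S" by auto
    let ?u = "\<Oplus>s\<in>T. r s \<otimes> s" and ?w = "\<Oplus>s\<in>T. r s \<otimes> g s"
    have rT: "r s \<in> carrier R" "s \<in> carrier R" "s \<in> Idl S" "g s \<in> carrier R" if "s \<in> insert x T" for s
      using that TS r SI S(2) gS by auto
    have uI: "?u \<in> Idl S" using rT I.I_l_closed by (intro I.finsum_closed_ideal[OF insert(1)]) auto
    have wc: "?w \<in> carrier R" using rT by (intro finsum_closed) auto
    have rxI: "r x \<otimes> x \<in> Idl S" using rT[of x] I.I_l_closed by simp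
    have telescope: "A \<ominus> (D \<oplus> E) = (A \<ominus> (B \<oplus> C)) \<oplus> ((B \<ominus> D) \<oplus> (C \<ominus> E))"
      if "A \<in> carrier R" "B \<in> carrier R" "C \<in> carrier R" "D \<in> carrier R" "E \<in> carrier R" for A B C D E
    proof -
      have 1: "A \<ominus> Q = (A \<ominus> P) \<oplus> (P \<ominus> Q)" if "P \<in> carrier R" "Q \<in> carrier R" for P Q
        using that \<open>A \<in> carrier R\<close> by algebra
      have 2: "(B \<ominus> D) \<oplus> (C \<ominus> E) = (B \<oplus> C) \<ominus> (D \<oplus> E)" using that by algebra
      show ?thesis unfolding 2 using that by (intro 1) simp_all
    qed
    have e: "(\<Oplus>s\<in>insert x T. r s \<otimes> s) = r x \<otimes> x \<oplus> ?u"
      "(\<Oplus>s\<in>insert x T. r s \<otimes> g s) = r x \<otimes> g x \<oplus> ?w"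
      using insert(1,2) rT by (simp_all add: Pi_iff finsum_insert)
    \<comment> \<open>The error for \<open>insert x T\<close> splits into an error of additivity,
      one of homogeneity and the error for \<open>T\<close>.\<close>
    have "g (r x \<otimes> x \<oplus> ?u) \<ominus> (r x \<otimes> g x \<oplus> ?w) =
        (g (r x \<otimes> x \<oplus> ?u) \<ominus> (g (r x \<otimes> x) \<oplus> g ?u)) \<oplus>
        ((g (r x \<otimes> x) \<ominus> r x \<otimes> g x) \<oplus> (g ?u \<ominus> ?w))"
      using rT[of x] wc gI(2)[OF uI] gI(2)[OF rxI] gI(2)[OF I.a_closed[OF rxI uI]]
      by (intro telescope) simp_all
    also have "\<dots> \<in> X"
      using ladd[OF rxI uI] lmul[of "r x" x] insert(3)[OF TS(1)] rT[of x] by simp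
    finally show ?case unfolding e .
  qed
  have lift: "f v \<ominus> g v \<in> X" if v: "v \<in> Idl S" for v
  proof -
    have k: "\<kappa> v \<in> S \<rightarrow> carrier R" "(\<Oplus>s\<in>S. \<kappa> v s \<otimes> s) = v" using \<kappa>[OF v] by auto
    have "g v \<ominus> f v \<in> X" using part[OF S(1) subset_refl k(1)] k(2) by (simp add: f_def)
    then have "\<ominus> (g v \<ominus> f v) \<in> X" by simp
    moreover have "\<ominus> (g v \<ominus> f v) = f v \<ominus> g v"
      using gI(2)[OF v] I.Icarr[OF fcl[OF v]] by algebra
    ultimately show ?thesis by simp
  qed
  show "\<exists>f. f \<in> Idl S \<rightarrow> Idl S \<and> lin_on R (Idl S) f \<and> (\<forall>v\<in>Idl S. f v \<ominus> g v \<in> X)"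
    unfolding lin_on_def using fcl add mul lift by (intro exI[of _ f]) simp
qed

section \<open>Minimal generating sets\<close>

lemma (in cring) Idl_eq_if_subset_Idl:
  assumes "S \<subseteq> carrier R" "T \<subseteq> carrier R" "S \<subseteq> Idl T" "T \<subseteq> Idl S"
  shows "Idl S = Idl T"
  using assms by (intro equalityI genideal_minimal genideal_ideal)

text \<open>The commutation relation \<open>b a - a b = 0\<close> has coefficients \<open>b\<close>
  and \<open>- a\<close>; independence makes both annihilate \<open>a\<close>.\<close>

lemma (in cring) indep_pair_mult_zero:
  assumes ab: "a \<in> carrier R" "b \<in> carrier R" "indep_pair R a b"
  shows "a \<otimes> a = \<zero>" "a \<otimes> b = \<zero>"
proof -
  have "b \<otimes> a \<oplus> (\<ominus> a) \<otimes> b = \<zero>" using ab(1,2) by algebra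
  then have "b \<otimes> a = \<zero> \<and> (\<ominus> a) \<otimes> a = \<zero>"
    using ab a_inv_closed[OF ab(1)] unfolding indep_pair_def by blast
  moreover have "a \<otimes> a = \<ominus> ((\<ominus> a) \<otimes> a)" "a \<otimes> b = b \<otimes> a" using ab(1,2) by algebra+
  ultimately show "a \<otimes> a = \<zero>" "a \<otimes> b = \<zero>" by simp_all
qed

lemma (in cring) indep_pair_sym:
  assumes "a \<in> carrier R" "b \<in> carrier R" "indep_pair R a b"
  shows "indep_pair R b a"
  unfolding indep_pair_def
proof (intro ballI impI)
  fix r s assume rs: "r \<in> carrier R" "s \<in> carrier R" "r \<otimes> b \<oplus> s \<otimes> a = \<zero>"
  then have "s \<otimes> a \<oplus> r \<otimes> b = \<zero>" using assms(1,2) by (simp add: a_comm)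
  then show "r \<otimes> b = \<zero> \<and> r \<otimes> a = \<zero> \<and> s \<otimes> b = \<zero> \<and> s \<otimes> a = \<zero>"
    using assms(3) rs(1,2) unfolding indep_pair_def by blast
qed

lemma (in cring) indep_pair_annihilator:
  assumes "a \<in> carrier R" "b \<in> carrier R" "indep_pair R a b" "r \<in> carrier R" "r \<otimes> a = \<zero>"
  shows "r \<otimes> b = \<zero>"
proof -
  have "r \<otimes> a \<oplus> \<zero> \<otimes> b = \<zero>" using assms by simp
  then show ?thesis using assms unfolding indep_pair_def by blast
qed

text \<open>\<open>J\<close> absorbs multiples, so an element of \<open>J\<close> never divides one
  outside \<open>J\<close>. Since elements outside are comparable with everything, the common
  divisor can be kept or replaced by the new coefficient as \<open>S\<close> grows.\<close>

lemma (in cring) exists_common_divisor: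
  assumes "finite S" "r \<in> S \<rightarrow> carrier R"
    and J: "\<And>x y. x \<in> J \<Longrightarrow> y \<in> carrier R \<Longrightarrow> x \<otimes> y \<in> J"
    and comp: "\<And>x y. x \<in> carrier R \<Longrightarrow> y \<in> carrier R \<Longrightarrow> x \<notin> J \<Longrightarrow> x divides y \<or> y divides x"
    and "\<exists>s\<in>S. r s \<notin> J"
  shows "\<exists>t\<in>S. r t \<notin> J \<and> (\<forall>s\<in>S. r t divides r s)"
  using assms(1,2,5)
proof (induct S)
  case empty
  then show ?case by simp
next
  case (insert x S)
  have c: "r x \<in> carrier R" "r \<in> S \<rightarrow> carrier R" using insert.prems(1) by auto
  have above: "u divides v" if "u \<in> carrier R" "v \<in> carrier R" "u \<notin> J" "v \<in> J" for u v
    using comp[OF that(1-3)] J[OF that(4)] that(3) unfolding factor_def by blast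
  show ?case
  proof (cases "\<exists>s\<in>S. r s \<notin> J")
    case False
    then have x: "r x \<notin> J" using insert.prems(2) by blast
    have "r x divides r x" using c(1) by simp
    moreover have "r x divides r s" if "s \<in> S" for s
    proof -
      have "r s \<in> J" using False that by simp
      then show ?thesis by (rule above[OF c(1) Pi_mem[OF c(2) that] x])
    qed
    ultimately show ?thesis using x by simp
  next
    case True
    then obtain t where t: "t \<in> S" "r t \<notin> J" "\<forall>s\<in>S. r t divides r s"
      using insert.hyps(3)[OF c(2)] by auto
    have tc: "r t \<in> carrier R" by (rule Pi_mem[OF c(2) t(1)])
    show ?thesis
    proof (cases "r t divides r x")
      case True
      then show ?thesis using t by blast
    next
      case False
      then have xt: "r x divides r t" and x: "r x \<notin> J"
        using comp[OF tc c(1) t(2)] above[OF tc c(1) t(2)] by auto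
      have "r x divides r x" using c(1) by simp
      moreover have "r x divides r s" if "s \<in> S" for s
        using divides_trans[OF xt _ c(1)] t(3) that by simp
      ultimately show ?thesis using x by simp
    qed
  qed
qed

text \<open>Minimality makes distinct generators incomparable, hence independent. If some
  coefficient did not annihilate all generators, one coefficient \<open>r t\<close> of this kind
  would divide all others, and factoring it out of the relation would lead to a generator
  \<open>t'\<close> with \<open>r t \<otimes> t' = \<zero>\<close>. Comparing \<open>t'\<close> with
  another generator is contradictory in each case.\<close>

lemma (in cring) relations_trivial_if_minimal:
  assumes CI: "chained_or_indep R"
    and S: "finite S" "S \<subseteq> carrier R"
    and min: "\<And>T. finite T \<Longrightarrow> T \<subseteq> carrier R \<Longrightarrow> Idl T = Idl S \<Longrightarrow> card S \<le> card T"
    and r: "r \<in> S \<rightarrow> carrier R" "(\<Oplus>s\<in>S. r s \<otimes> s) = \<zero>"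
    and st: "s \<in> S" "t \<in> S"
  shows "r s \<otimes> t = \<zero>"
proof (cases "S = {s}")
  case True
  then have "(\<Oplus>s\<in>S. r s \<otimes> s) = r s \<otimes> s" using r(1) S(2) by simp
  then show ?thesis using True r st by simp
next
  case False
  have CI': "a divides b \<or> b divides a \<or> indep_pair R a b"
    if "a \<in> carrier R" "b \<in> carrier R" for a b
    using CI that unfolding chained_or_indep_def by blast
  have notin: "t \<notin> Idl (S - {t})" if "t \<in> S" for t
  proof
    assume t: "t \<in> Idl (S - {t})"
    have "S - {t} \<subseteq> Idl (S - {t})" using S by (intro genideal_self) auto
    then have "Idl (S - {t}) = Idl S"
      using t S genideal_self[OF S(2)] by (intro Idl_eq_if_subset_Idl) auto
    then show False using min[of "S - {t}"] S that card_Diff1_less[OF S(1) that] by auto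
  qed
  have inc: "\<not> s divides t" if "s \<in> S" "t \<in> S" "s \<noteq> t" for s t
  proof
    assume "s divides t"
    then obtain c where c: "c \<in> carrier R" "t = s \<otimes> c" by (auto simp: factor_def)
    interpret I: ideal "Idl (S - {t})" R using S by (intro genideal_ideal) auto
    have "s \<in> Idl (S - {t})" using genideal_self[of "S - {t}"] S that by blast
    then show False using notin[OF that(2)] c I.I_r_closed by simp
  qed
  have ind: "indep_pair R s t" if "s \<in> S" "t \<in> S" "s \<noteq> t" for s t
    using CI'[of s t] inc[of s t] inc[of t s] that S by blast
  have other: "\<exists>u\<in>S. u \<noteq> s" if "s \<in> S" for s
  proof (rule ccontr)
    assume "\<not> ?thesis"
    then have "S = {s}" using that by blast
    then show False using False st by blast
  qed
  have sq: "s \<otimes> s = \<zero>" if s: "s \<in> S" for s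
  proof -
    obtain u where u: "u \<in> S" "u \<noteq> s" using other[OF s] by blast
    then show ?thesis using indep_pair_mult_zero(1)[of s u] ind[of s u] s S by blast
  qed
  \<comment> \<open>\<open>J\<close> is the common annihilator of all elements of \<open>S\<close>; an element outside \<open>J\<close> is
    comparable with every element of the ring.\<close>
  define J where "J = {x \<in> carrier R. \<forall>s\<in>S. x \<otimes> s = \<zero>}"
  \<comment> \<open>Independent elements have the same annihilator, so killing one generator amounts
    to killing all of them.\<close>
  have inJ: "x \<in> J" if x: "x \<in> carrier R" "s \<in> S" "x \<otimes> s = \<zero>" for x s
    using indep_pair_annihilator[of s _ x] ind x S unfolding J_def by (auto simp: subset_iff)
  have Jmult: "x \<otimes> y \<in> J" if x: "x \<in> J" and y: "y \<in> carrier R" for x y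
  proof -
    have "(x \<otimes> y) \<otimes> s = y \<otimes> (x \<otimes> s)" if "s \<in> carrier R" for s
      using x y that unfolding J_def by (auto simp: m_ac)
    then show ?thesis using x y S(2) unfolding J_def by auto
  qed
  have comp: "x divides y \<or> y divides x"
    if x: "x \<in> carrier R" "y \<in> carrier R" "x \<notin> J" for x y
  proof (rule ccontr)
    assume "\<not> ?thesis"
    \<comment> \<open>An incomparable pair would be independent, so \<open>x\<close> squares to
      zero; comparing \<open>x\<close> with a generator then puts \<open>x\<close> into
      \<open>J\<close>.\<close>
    then have xx: "x \<otimes> x = \<zero>" using CI' x(1,2) indep_pair_mult_zero(1) by blast
    have sc: "s \<in> carrier R" using st S by blast
    consider c where "c \<in> carrier R" "s = x \<otimes> c" | c where "c \<in> carrier R" "x = s \<otimes> c" | "indep_pair R x s"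
      using CI'[OF x(1) sc] unfolding factor_def by blast
    then have "x \<otimes> s = \<zero>"
    proof cases
      case (1 c)
      then have "x \<otimes> s = (x \<otimes> x) \<otimes> c" using x by (simp only: m_assoc)
      then show ?thesis using xx 1 by simp
    next
      case (2 c)
      then have "x \<otimes> s = (s \<otimes> s) \<otimes> c" using sc by (simp only: m_ac m_closed)
      then show ?thesis using sq st 2 by simp
    next
      case 3
      then show ?thesis using indep_pair_mult_zero(2) x sc by blast
    qed
    then show False using inJ x st(1) by blast
  qed
  have "r s \<in> J" if s: "s \<in> S" for s
  proof (rule ccontr)
    assume "r s \<notin> J"
    then obtain t where t: "t \<in> S" "r t \<notin> J" "\<forall>s\<in>S. r t divides r s"
      using exists_common_divisor[OF S(1) r(1) Jmult comp] s by blast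
    then obtain c where c: "\<And>s. s \<in> S \<Longrightarrow> c s \<in> carrier R \<and> r s = r t \<otimes> c s"
      unfolding factor_def by metis
    obtain u where u: "u \<in> S" "u \<noteq> t" using other[OF t(1)] by blast
    have carr: "t \<in> carrier R" "u \<in> carrier R" "r t \<in> carrier R" using t(1) u S(2) r(1) by auto
    let ?S' = "S - {t}"
    have S': "finite ?S'" "?S' \<subseteq> carrier R" using S by auto
    interpret I': ideal "Idl ?S'" R by (rule genideal_ideal[OF S'(2)])
    define w where "w = (\<Oplus>s\<in>?S'. c s \<otimes> s)"
    \<comment> \<open>The relation reads \<open>r t \<otimes> t' = \<zero>\<close>, and \<open>t'\<close> can replace \<open>t\<close> as a generator.\<close>
    define t' where "t' = t \<oplus> w"
    have w: "w \<in> Idl ?S'"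
      unfolding w_def using c genideal_self[OF S'(2)] I'.I_l_closed
      by (intro I'.finsum_closed_ideal[OF S'(1)]) auto
    have wc: "w \<in> carrier R" "t' \<in> carrier R" using w I'.Icarr carr by (auto simp: t'_def)
    have t't: "t = t' \<ominus> w" unfolding t'_def using carr wc(1) by algebra
    have rt': "r t \<otimes> t' = \<zero>"
    proof -
      have cS: "c \<in> ?S' \<rightarrow> carrier R" "(\<lambda>s. s) \<in> ?S' \<rightarrow> carrier R" using c S' by auto
      have "\<zero> = (\<Oplus>s\<in>insert t ?S'. r s \<otimes> s)" using r(2) t(1) by (simp add: insert_absorb)
      also have "\<dots> = r t \<otimes> t \<oplus> (\<Oplus>s\<in>?S'. r s \<otimes> s)"
        using S' r(1) carr by (intro finsum_insert) auto
      also have "(\<Oplus>s\<in>?S'. r s \<otimes> s) = (\<Oplus>s\<in>?S'. (r t \<otimes> c s) \<otimes> s)"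
        using c carr S' by (intro finsum_cong') auto
      also have "\<dots> = r t \<otimes> w"
        unfolding w_def by (rule finsum_coeff_mult[OF S'(1) cS(1) carr(3) cS(2)])
      finally show ?thesis unfolding t'_def using carr wc by (simp add: r_distr)
    qed
    consider d where "d \<in> carrier R" "t' = u \<otimes> d" | d where "d \<in> carrier R" "u = t' \<otimes> d"
      | "indep_pair R t' u"
      using CI'[OF wc(2) carr(2)] unfolding factor_def by blast
    then show False
    proof cases
      \<comment> \<open>If \<open>u\<close> divides \<open>t'\<close>, then
        \<open>t = t' - w\<close> is generated by the other elements of \<open>S\<close>.\<close>
      case (1 d)
      have "u \<in> Idl ?S'" using genideal_self[OF S'(2)] u by blast
      then have "t' \<in> Idl ?S'" using 1 I'.I_r_closed by simp
      then have "t' \<ominus> w \<in> Idl ?S'" using w by (simp add: a_minus_def)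
      then have "t \<in> Idl ?S'" by (simp only: t't[symmetric])
      then show False using notin t(1) by blast
    next
      \<comment> \<open>If \<open>t'\<close> divides \<open>u\<close>, then \<open>t'\<close>
        replaces both \<open>t\<close> and \<open>u\<close>, which yields a smaller generating
        set.\<close>
      case (2 d)
      let ?T = "insert t' (S - {t, u})"
      have T: "finite ?T" "?T \<subseteq> carrier R" using S wc by auto
      interpret T: ideal "Idl ?T" R by (rule genideal_ideal[OF T(2)])
      interpret I: ideal "Idl S" R by (rule genideal_ideal[OF S(2)])
      have TI: "?T \<subseteq> Idl ?T" by (rule genideal_self[OF T(2)])
      then have "u \<in> Idl ?T" using 2 T.I_r_closed by simp
      then have S'T: "?S' \<subseteq> Idl ?T" using TI by auto
      then have "w \<in> Idl ?T" using genideal_minimal[OF T.is_ideal S'T] w by blast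
      then have "t' \<ominus> w \<in> Idl ?T" using TI by (simp add: a_minus_def)
      then have "t \<in> Idl ?T" by (simp only: t't[symmetric])
      then have ST: "S \<subseteq> Idl ?T" using S'T by auto
      have "Idl ?S' \<subseteq> Idl S" using S by (intro subset_Idl_subset) auto
      then have "t' \<in> Idl S" unfolding t'_def using w t(1) genideal_self[OF S(2)] I.a_closed by blast
      then have TS: "?T \<subseteq> Idl S" using genideal_self[OF S(2)] by auto
      have "card S \<le> card ?T" by (rule min[OF T Idl_eq_if_subset_Idl[OF T(2) S(2) TS ST]])
      also have "\<dots> \<le> Suc (card (S - {t, u}))" using S(1) by (simp add: card_insert_le_m1 card_insert_if)
      also have "card (S - {t, u}) = card S - 2" using t(1) u S(1) by (subst card_Diff_subset) auto
      finally have "card S \<le> Suc (card S - 2)" .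
      \<comment> \<open>Subtraction of naturals is truncated, so the bound is contradictory only
        because \<open>S\<close> has two distinct elements.\<close>
      moreover have "2 \<le> card S" using card_mono[of S "{t, u}"] S(1) t(1) u by auto
      ultimately show False by simp
    next
      \<comment> \<open>\<open>r t\<close> annihilates \<open>t'\<close>, hence also
        \<open>u\<close>, and would belong to \<open>J\<close>.\<close>
      case 3
      then have "r t \<otimes> u = \<zero>" using indep_pair_annihilator rt' wc carr by blast
      then show False using inJ carr u(1) t(2) by blast
    qed
  qed
  then show ?thesis using st unfolding J_def by blast
qed

lemma (in cring) chained_or_indep_imp_fqp_ring:
  assumes CI: "chained_or_indep R"
  shows "fqp_ring R"
  unfolding fqp_ring_def
proof (intro allI impI)
  fix S assume S: "finite S" "S \<subseteq> carrier R"
  let ?P = "\<lambda>T. finite T \<and> T \<subseteq> carrier R \<and> Idl T = Idl S"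
  obtain T where T: "?P T" and min: "\<And>T'. ?P T' \<Longrightarrow> card T \<le> card T'"
    using ex_has_least_nat[of ?P S card] S by auto
  have "quasi_projective_ideal R (Idl T)"
    using T min by (intro quasi_projective_if_relations_trivial relations_trivial_if_minimal[OF CI]) auto
  then show "quasi_projective_ideal R (Idl S)" using T by simp
qed

lemma (in local_cring) fqp_ring_iff_chained_or_indep: "fqp_ring R \<longleftrightarrow> chained_or_indep R"
  using fqp_ring_imp_chained_or_indep chained_or_indep_imp_fqp_ring by blast

section \<open>Trivial ring extensions\<close>

lemma triv_ext_simps [simp]:
  "carrier (triv_ext A E) = carrier A \<times> carrier E"
  "\<one>\<^bsub>triv_ext A E\<^esub> = (\<one>\<^bsub>A\<^esub>, \<zero>\<^bsub>E\<^esub>)"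
  "\<zero>\<^bsub>triv_ext A E\<^esub> = (\<zero>\<^bsub>A\<^esub>, \<zero>\<^bsub>E\<^esub>)"
  "(a, e) \<otimes>\<^bsub>triv_ext A E\<^esub> (b, f) = (a \<otimes>\<^bsub>A\<^esub> b, (a \<odot>\<^bsub>E\<^esub> f) \<oplus>\<^bsub>E\<^esub> (b \<odot>\<^bsub>E\<^esub> e))"
  "(a, e) \<oplus>\<^bsub>triv_ext A E\<^esub> (b, f) = (a \<oplus>\<^bsub>A\<^esub> b, e \<oplus>\<^bsub>E\<^esub> f)"
  by (simp_all add: triv_ext_def)

locale triv_ext_module = module R M
  for R :: "('a, 'c) ring_scheme" (structure) and M :: "('a, 'b) module" (structure)
begin

lemma triv_ext_cring: "cring (triv_ext R M)"
proof (rule cringI)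
  show "abelian_group (triv_ext R M)"
  proof (rule abelian_groupI)
    fix x assume "x \<in> carrier (triv_ext R M)"
    then obtain a e where x: "x = (a, e)" "a \<in> carrier R" "e \<in> carrier M" by auto
    then show "\<exists>y\<in>carrier (triv_ext R M). y \<oplus>\<^bsub>triv_ext R M\<^esub> x = \<zero>\<^bsub>triv_ext R M\<^esub>"
      by (intro bexI[of _ "(\<ominus> a, \<ominus>\<^bsub>M\<^esub> e)"]) (simp_all add: R.l_neg M.l_neg)
  qed (auto simp: R.a_ac M.a_ac)
  show "comm_monoid (triv_ext R M)"
  proof (rule comm_monoidI)
    fix x y assume "x \<in> carrier (triv_ext R M)" "y \<in> carrier (triv_ext R M)"
    then show "x \<otimes>\<^bsub>triv_ext R M\<^esub> y = y \<otimes>\<^bsub>triv_ext R M\<^esub> x"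
      by (auto simp: R.m_comm M.a_comm)
  next
    fix x y z assume "x \<in> carrier (triv_ext R M)" "y \<in> carrier (triv_ext R M)" "z \<in> carrier (triv_ext R M)"
    then obtain a e b f c g where "x = (a, e)" "a \<in> carrier R" "e \<in> carrier M"
      "y = (b, f)" "b \<in> carrier R" "f \<in> carrier M" "z = (c, g)" "c \<in> carrier R" "g \<in> carrier M"
      by auto
    moreover have "c \<odot>\<^bsub>M\<^esub> (b \<odot>\<^bsub>M\<^esub> e) = (b \<otimes> c) \<odot>\<^bsub>M\<^esub> e" "c \<odot>\<^bsub>M\<^esub> (a \<odot>\<^bsub>M\<^esub> f) = a \<odot>\<^bsub>M\<^esub> (c \<odot>\<^bsub>M\<^esub> f)"
      using calculation by (simp_all add: smult_assoc1[symmetric] R.m_comm)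
    ultimately show "x \<otimes>\<^bsub>triv_ext R M\<^esub> y \<otimes>\<^bsub>triv_ext R M\<^esub> z = x \<otimes>\<^bsub>triv_ext R M\<^esub> (y \<otimes>\<^bsub>triv_ext R M\<^esub> z)"
      by (simp add: R.m_assoc smult_r_distr M.a_assoc smult_assoc1)
  qed (auto simp: R.m_comm)
  fix x y z assume "x \<in> carrier (triv_ext R M)" "y \<in> carrier (triv_ext R M)" "z \<in> carrier (triv_ext R M)"
  then show "(x \<oplus>\<^bsub>triv_ext R M\<^esub> y) \<otimes>\<^bsub>triv_ext R M\<^esub> z =
      x \<otimes>\<^bsub>triv_ext R M\<^esub> z \<oplus>\<^bsub>triv_ext R M\<^esub> y \<otimes>\<^bsub>triv_ext R M\<^esub> z"
    by (auto simp: R.l_distr smult_l_distr smult_r_distr M.a_ac)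
qed

text \<open>With \<open>i\<close> the inverse of \<open>a\<close>, solving
  \<open>a f + i e = 0\<close> gives the second component \<open>f = - i i e\<close> of the
  inverse.\<close>

lemma triv_ext_Units:
  assumes a: "a \<in> Units R" and e: "e \<in> carrier M"
  shows "(a, e) \<in> Units (triv_ext R M)"
proof -
  let ?i = "inv a"
  let ?f = "\<ominus>\<^bsub>M\<^esub> (?i \<odot>\<^bsub>M\<^esub> (?i \<odot>\<^bsub>M\<^esub> e))"
  have c: "a \<in> carrier R" "?i \<in> carrier R" using a by auto
  have "a \<odot>\<^bsub>M\<^esub> ?f = \<ominus>\<^bsub>M\<^esub> ((a \<otimes> ?i) \<odot>\<^bsub>M\<^esub> (?i \<odot>\<^bsub>M\<^esub> e))"
    using c e by (simp add: smult_r_minus smult_assoc1 del: R.Units_r_inv)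
  then have af: "a \<odot>\<^bsub>M\<^esub> ?f = \<ominus>\<^bsub>M\<^esub> (?i \<odot>\<^bsub>M\<^esub> e)" using a c e by simp
  interpret T: cring "triv_ext R M" by (rule triv_ext_cring)
  have m: "(a, e) \<otimes>\<^bsub>triv_ext R M\<^esub> (?i, ?f) = \<one>\<^bsub>triv_ext R M\<^esub>"
    using a c e af by (simp add: M.l_neg)
  have cc: "(a, e) \<in> carrier (triv_ext R M)" "(?i, ?f) \<in> carrier (triv_ext R M)" using c e by simp_all
  show ?thesis
    unfolding Units_def using m T.m_comm[OF cc] cc by auto
qed

lemma triv_ext_local_cring:
  assumes "local_cring R"
  shows "local_cring (triv_ext R M)"
proof -
  interpret L: local_cring R by (rule assms)
  interpret T: cring "triv_ext R M" by (rule triv_ext_cring)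
  show ?thesis
  proof
    show "\<one>\<^bsub>triv_ext R M\<^esub> \<noteq> \<zero>\<^bsub>triv_ext R M\<^esub>" using L.one_not_zero by simp
    fix x assume x: "x \<in> carrier (triv_ext R M)"
    then obtain a e where ae: "x = (a, e)" "a \<in> carrier R" "e \<in> carrier M" by auto
    have "\<ominus>\<^bsub>triv_ext R M\<^esub> x = (\<ominus> a, \<ominus>\<^bsub>M\<^esub> e)"
      using ae by (intro T.minus_equality) (simp_all add: R.l_neg M.l_neg)
    then have "\<one>\<^bsub>triv_ext R M\<^esub> \<ominus>\<^bsub>triv_ext R M\<^esub> x = (\<one> \<ominus> a, \<ominus>\<^bsub>M\<^esub> e)"
      using ae by (simp add: a_minus_def)
    then show "x \<in> Units (triv_ext R M) \<or> \<one>\<^bsub>triv_ext R M\<^esub> \<ominus>\<^bsub>triv_ext R M\<^esub> x \<in> Units (triv_ext R M)"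
      using L.unit_or_unit[OF ae(2)] ae triv_ext_Units by auto
  qed
qed

lemma triv_ext_divides:
  "(a, e) divides\<^bsub>triv_ext R M\<^esub> (b, f) \<longleftrightarrow>
    (\<exists>c\<in>carrier R. \<exists>g\<in>carrier M. b = a \<otimes> c \<and> f = a \<odot>\<^bsub>M\<^esub> g \<oplus>\<^bsub>M\<^esub> c \<odot>\<^bsub>M\<^esub> e)"
  by (auto simp: factor_def)

text \<open>A quotient \<open>c\<close> of the first components leaves the equation
  \<open>a g = f - c e\<close>, which is solvable because \<open>a\<close> acts
  surjectively.\<close>

lemma triv_ext_divides_if_divisible:
  assumes carr: "a \<in> carrier R" "e \<in> carrier M" "f \<in> carrier M"
    and dvd: "a divides b" and div: "\<And>x. x \<in> carrier M \<Longrightarrow> \<exists>g\<in>carrier M. x = a \<odot>\<^bsub>M\<^esub> g"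
  shows "(a, e) divides\<^bsub>triv_ext R M\<^esub> (b, f)"
proof -
  obtain c where c: "c \<in> carrier R" "b = a \<otimes> c" using dvd by (auto simp: factor_def)
  obtain g where g: "g \<in> carrier M" "f \<ominus>\<^bsub>M\<^esub> c \<odot>\<^bsub>M\<^esub> e = a \<odot>\<^bsub>M\<^esub> g"
    using div[of "f \<ominus>\<^bsub>M\<^esub> c \<odot>\<^bsub>M\<^esub> e"] c carr by auto
  have "f = (f \<ominus>\<^bsub>M\<^esub> c \<odot>\<^bsub>M\<^esub> e) \<oplus>\<^bsub>M\<^esub> c \<odot>\<^bsub>M\<^esub> e"
    using carr c by (simp add: a_minus_def M.a_assoc M.l_neg)
  then show ?thesis unfolding triv_ext_divides using c g by auto
qed

lemma cyclic_submodule: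
  assumes e: "e \<in> carrier M"
  shows "submodule {c \<odot>\<^bsub>M\<^esub> e | c. c \<in> carrier R} R M"
proof (rule submoduleI)
  show "{c \<odot>\<^bsub>M\<^esub> e |c. c \<in> carrier R} \<subseteq> carrier M" using e by auto
  show "\<zero>\<^bsub>M\<^esub> \<in> {c \<odot>\<^bsub>M\<^esub> e |c. c \<in> carrier R}" using e by (auto intro!: exI[of _ \<zero>])
  show "\<ominus>\<^bsub>M\<^esub> x \<in> {c \<odot>\<^bsub>M\<^esub> e |c. c \<in> carrier R}" if x: "x \<in> {c \<odot>\<^bsub>M\<^esub> e |c. c \<in> carrier R}" for x
  proof -
    obtain c where "c \<in> carrier R" "x = c \<odot>\<^bsub>M\<^esub> e" using x by blast
    then show ?thesis using e by (auto intro!: exI[of _ "\<ominus> c"] simp: smult_l_minus)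
  qed
  show "x \<oplus>\<^bsub>M\<^esub> y \<in> {c \<odot>\<^bsub>M\<^esub> e |c. c \<in> carrier R}"
    if xy: "x \<in> {c \<odot>\<^bsub>M\<^esub> e |c. c \<in> carrier R}" "y \<in> {c \<odot>\<^bsub>M\<^esub> e |c. c \<in> carrier R}" for x y
  proof -
    obtain c d where "c \<in> carrier R" "x = c \<odot>\<^bsub>M\<^esub> e" "d \<in> carrier R" "y = d \<odot>\<^bsub>M\<^esub> e" using xy by blast
    then show ?thesis using e by (auto intro!: exI[of _ "c \<oplus> d"] simp: smult_l_distr)
  qed
  show "a \<odot>\<^bsub>M\<^esub> x \<in> {c \<odot>\<^bsub>M\<^esub> e |c. c \<in> carrier R}"
    if a: "a \<in> carrier R" and x: "x \<in> {c \<odot>\<^bsub>M\<^esub> e |c. c \<in> carrier R}" for a x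
  proof -
    obtain c where "c \<in> carrier R" "x = c \<odot>\<^bsub>M\<^esub> e" using x by blast
    then show ?thesis using e a by (auto intro!: exI[of _ "a \<otimes> c"] simp: smult_assoc1)
  qed
qed

text \<open>Only cyclic submodules have to be compared: of an element of \<open>H\<close> outside
  \<open>K\<close> and one of \<open>K\<close> outside \<open>H\<close>, neither can be a multiple
  of the other.\<close>

lemma uniserial_iff:
  "uniserial R M \<longleftrightarrow> (\<forall>e\<in>carrier M. \<forall>f\<in>carrier M.
     (\<exists>c\<in>carrier R. f = c \<odot>\<^bsub>M\<^esub> e) \<or> (\<exists>c\<in>carrier R. e = c \<odot>\<^bsub>M\<^esub> f))" (is "_ \<longleftrightarrow> ?C")
proof
  assume U: "uniserial R M"
  show ?C
  proof (intro ballI)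
    fix e f assume ef: "e \<in> carrier M" "f \<in> carrier M"
    have "e \<in> {c \<odot>\<^bsub>M\<^esub> e |c. c \<in> carrier R}" "f \<in> {c \<odot>\<^bsub>M\<^esub> f |c. c \<in> carrier R}"
      using ef by (auto intro!: exI[of _ \<one>])
    moreover have "{c \<odot>\<^bsub>M\<^esub> e |c. c \<in> carrier R} \<subseteq> {c \<odot>\<^bsub>M\<^esub> f |c. c \<in> carrier R} \<or>
        {c \<odot>\<^bsub>M\<^esub> f |c. c \<in> carrier R} \<subseteq> {c \<odot>\<^bsub>M\<^esub> e |c. c \<in> carrier R}"
      using U cyclic_submodule[OF ef(1)] cyclic_submodule[OF ef(2)] unfolding uniserial_def by blast
    ultimately show "(\<exists>c\<in>carrier R. f = c \<odot>\<^bsub>M\<^esub> e) \<or> (\<exists>c\<in>carrier R. e = c \<odot>\<^bsub>M\<^esub> f)" by blast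
  qed
next
  assume C: ?C
  show "uniserial R M"
    unfolding uniserial_def
  proof (intro allI impI)
    fix H K assume HK: "submodule H R M" "submodule K R M"
    show "H \<subseteq> K \<or> K \<subseteq> H"
    proof (rule ccontr)
      assume "\<not> ?thesis"
      then obtain h k where hk: "h \<in> H" "h \<notin> K" "k \<in> K" "k \<notin> H" by blast
      have "h \<in> carrier M" "k \<in> carrier M" using hk submoduleE(1)[OF HK(1)] submoduleE(1)[OF HK(2)] by auto
      then show False using C hk submoduleE(4)[OF HK(1)] submoduleE(4)[OF HK(2)] by metis
    qed
  qed
qed

section \<open>Comparability and independence in the extension\<close>

text \<open>Any two elements turn out comparable. A non-zero ring element acts surjectively on
  \<open>M\<close>, so divisibility of first components suffices; if both first components vanish,
  uniseriality decides.\<close>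

lemma triv_ext_chained:
  assumes V: "valuation_domain R" and D: "divisible_module R M" and U: "uniserial R M"
  shows "chained_or_indep (triv_ext R M)"
proof -
  interpret D: domain R using V by (simp add: valuation_domain_def)
  have div: "\<exists>g\<in>carrier M. x = a \<odot>\<^bsub>M\<^esub> g" if "a \<in> carrier R" "a \<noteq> \<zero>" "x \<in> carrier M" for a x
    using D that D.integral unfolding divisible_module_def regular_elem_def zero_divisor_def by blast
  have dvd: "a divides b \<or> b divides a" if "a \<in> carrier R" "b \<in> carrier R" for a b
    using V that unfolding valuation_domain_def factor_def by blast
  have z: "a = \<zero>" if "\<zero> divides a" "a \<in> carrier R" for a
    using that by (auto simp: factor_def)
  have "(a, e) divides\<^bsub>triv_ext R M\<^esub> (b, f) \<or> (b, f) divides\<^bsub>triv_ext R M\<^esub> (a, e)"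
    if c: "a \<in> carrier R" "b \<in> carrier R" "e \<in> carrier M" "f \<in> carrier M" for a b e f
  proof (cases "a = \<zero> \<and> b = \<zero>")
    case True
    have "(\<exists>c\<in>carrier R. f = c \<odot>\<^bsub>M\<^esub> e) \<or> (\<exists>c\<in>carrier R. e = c \<odot>\<^bsub>M\<^esub> f)"
      using U c unfolding uniserial_iff by blast
    then show ?thesis
    proof (elim disjE bexE)
      fix d assume "d \<in> carrier R" "f = d \<odot>\<^bsub>M\<^esub> e"
      then have "(a, e) divides\<^bsub>triv_ext R M\<^esub> (b, f)"
        unfolding triv_ext_divides using True c by (intro bexI[of _ d] bexI[of _ "\<zero>\<^bsub>M\<^esub>"]) auto
      then show ?thesis ..
    next
      fix d assume "d \<in> carrier R" "e = d \<odot>\<^bsub>M\<^esub> f"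
      then have "(b, f) divides\<^bsub>triv_ext R M\<^esub> (a, e)"
        unfolding triv_ext_divides using True c by (intro bexI[of _ d] bexI[of _ "\<zero>\<^bsub>M\<^esub>"]) auto
      then show ?thesis ..
    qed
  next
    case False
    \<comment> \<open>\<open>\<zero>\<close> divides only itself, so the dividing component may be
      taken non-zero.\<close>
    then have "(a \<noteq> \<zero> \<and> a divides b) \<or> (b \<noteq> \<zero> \<and> b divides a)"
      using dvd[OF c(1,2)] z c(1,2) by blast
    then show ?thesis
      using triv_ext_divides_if_divisible[OF c(1,3,4)] triv_ext_divides_if_divisible[OF c(2,4,3)]
        div c by blast
  qed
  then show ?thesis by (simp add: chained_or_indep_def) blast
qed

text \<open>The embedding \<open>a \<mapsto> (a, 0)\<close> reflects divisibility and independence,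
  as first components show.\<close>

lemma triv_ext_chained_or_indep_imp_base:
  assumes "chained_or_indep (triv_ext R M)"
  shows "chained_or_indep R"
  unfolding chained_or_indep_def
proof (intro ballI)
  fix a b assume ab: "a \<in> carrier R" "b \<in> carrier R"
  then have "(a, \<zero>\<^bsub>M\<^esub>) divides\<^bsub>triv_ext R M\<^esub> (b, \<zero>\<^bsub>M\<^esub>) \<or>
      (b, \<zero>\<^bsub>M\<^esub>) divides\<^bsub>triv_ext R M\<^esub> (a, \<zero>\<^bsub>M\<^esub>) \<or>
      indep_pair (triv_ext R M) (a, \<zero>\<^bsub>M\<^esub>) (b, \<zero>\<^bsub>M\<^esub>)"
    using assms unfolding chained_or_indep_def by simp
  then show "a divides b \<or> b divides a \<or> indep_pair R a b"
  proof (elim disjE)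
    assume I: "indep_pair (triv_ext R M) (a, \<zero>\<^bsub>M\<^esub>) (b, \<zero>\<^bsub>M\<^esub>)"
    have "indep_pair R a b"
      unfolding indep_pair_def
    proof (intro ballI impI)
      fix r s assume rs: "r \<in> carrier R" "s \<in> carrier R" "r \<otimes> a \<oplus> s \<otimes> b = \<zero>"
      have "(r, \<zero>\<^bsub>M\<^esub>) \<in> carrier (triv_ext R M)" "(s, \<zero>\<^bsub>M\<^esub>) \<in> carrier (triv_ext R M)" using rs by simp_all
      moreover have "(r, \<zero>\<^bsub>M\<^esub>) \<otimes>\<^bsub>triv_ext R M\<^esub> (a, \<zero>\<^bsub>M\<^esub>) \<oplus>\<^bsub>triv_ext R M\<^esub>
          (s, \<zero>\<^bsub>M\<^esub>) \<otimes>\<^bsub>triv_ext R M\<^esub> (b, \<zero>\<^bsub>M\<^esub>) = \<zero>\<^bsub>triv_ext R M\<^esub>"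
        using rs ab by simp
      ultimately have "(r, \<zero>\<^bsub>M\<^esub>) \<otimes>\<^bsub>triv_ext R M\<^esub> (a, \<zero>\<^bsub>M\<^esub>) = \<zero>\<^bsub>triv_ext R M\<^esub> \<and>
          (r, \<zero>\<^bsub>M\<^esub>) \<otimes>\<^bsub>triv_ext R M\<^esub> (b, \<zero>\<^bsub>M\<^esub>) = \<zero>\<^bsub>triv_ext R M\<^esub> \<and>
          (s, \<zero>\<^bsub>M\<^esub>) \<otimes>\<^bsub>triv_ext R M\<^esub> (a, \<zero>\<^bsub>M\<^esub>) = \<zero>\<^bsub>triv_ext R M\<^esub> \<and>
          (s, \<zero>\<^bsub>M\<^esub>) \<otimes>\<^bsub>triv_ext R M\<^esub> (b, \<zero>\<^bsub>M\<^esub>) = \<zero>\<^bsub>triv_ext R M\<^esub>"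
        using I[unfolded indep_pair_def, rule_format] by blast
      then show "r \<otimes> a = \<zero> \<and> r \<otimes> b = \<zero> \<and> s \<otimes> a = \<zero> \<and> s \<otimes> b = \<zero>" by simp
    qed
    then show ?thesis by blast
  qed (auto simp: triv_ext_divides factor_def)
qed

text \<open>Powers of a cancellable \<open>a\<close> are cancellable, so \<open>b\<close> inherits
  nilpotency from \<open>a b\<close>. This turns regularity of \<open>a\<close> into regularity of
  its class modulo the nilradical.\<close>

lemma nilpotent_power_mult:
  assumes "a \<in> carrier R" "b \<in> carrier R" "a \<otimes> b \<in> nilradical R"
    and reg: "\<And>x. x \<in> carrier R \<Longrightarrow> a \<otimes> x = \<zero> \<Longrightarrow> x = \<zero>"
  shows "b \<in> nilradical R"
proof -
  obtain n where n: "(a \<otimes> b) [^] (n::nat) = \<zero>" using assms(3) by (auto simp: nilradical_def)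
  have *: "x = \<zero>" if "x \<in> carrier R" "a [^] k \<otimes> x = \<zero>" for k :: nat and x
    using that
  proof (induct k arbitrary: x)
    case 0
    then show ?case by simp
  next
    case (Suc k)
    have "a [^] k \<otimes> (a \<otimes> x) = \<zero>" using Suc.prems assms(1) by (simp add: R.m_assoc)
    then have "a \<otimes> x = \<zero>" by (rule Suc.hyps[rotated]) (use Suc.prems(1) assms(1) in simp)
    then show ?case by (rule reg[OF Suc.prems(1)])
  qed
  have "b [^] n = \<zero>" using n assms(1,2) by (intro *[of "b [^] n" n]) (simp_all add: R.nat_pow_distrib)
  then show ?thesis using assms(2) by (auto simp: nilradical_def)
qed

text \<open>The ideal product is built from products by sums, so it vanishes once all products do;
  it is non-empty since \<open>\<zero>\<close> is nilpotent.\<close>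

lemma nilradical_square_zero_iff:
  "nilradical R \<cdot>\<^bsub>R\<^esub> nilradical R = {\<zero>} \<longleftrightarrow> (\<forall>a\<in>nilradical R. \<forall>b\<in>nilradical R. a \<otimes> b = \<zero>)"
proof
  assume "nilradical R \<cdot>\<^bsub>R\<^esub> nilradical R = {\<zero>}"
  then show "\<forall>a\<in>nilradical R. \<forall>b\<in>nilradical R. a \<otimes> b = \<zero>"
    using ideal_prod.prod[of _ "nilradical R" _ "nilradical R" R] by blast
next
  assume *: "\<forall>a\<in>nilradical R. \<forall>b\<in>nilradical R. a \<otimes> b = \<zero>"
  have "x = \<zero>" if "x \<in> nilradical R \<cdot>\<^bsub>R\<^esub> nilradical R" for x
    using that by (induct rule: ideal_prod.induct) (use * in auto)
  moreover have "\<zero> \<in> nilradical R" by (auto simp: nilradical_def intro: exI[of _ 1])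
  then have "\<zero> \<in> nilradical R \<cdot>\<^bsub>R\<^esub> nilradical R"
    using ideal_prod.prod[of \<zero> "nilradical R" \<zero> "nilradical R" R] by simp
  ultimately show "nilradical R \<cdot>\<^bsub>R\<^esub> nilradical R = {\<zero>}" by blast
qed

text \<open>Elements outside the nilradical are cancellable, act bijectively on \<open>M\<close> and
  are comparable with every element. So a pair is comparable unless both first components are
  nilpotent. For such a pair, a relation with a non-nilpotent coefficient can be cancelled down to
  comparability, while nilpotent coefficients annihilate both elements.\<close>

lemma triv_ext_nonchained:
  assumes CI: "chained_or_indep R"
    and NM: "\<forall>a\<in>nilradical R. \<forall>e\<in>carrier M. a \<odot>\<^bsub>M\<^esub> e = \<zero>\<^bsub>M\<^esub>"
    and D: "divisible_mod_nil R M" and T: "torsionfree_mod_nil R M"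
    and Z: "\<forall>a. zero_divisor R a \<longrightarrow> a \<in> nilradical R"
    and NN: "\<forall>a\<in>nilradical R. \<forall>b\<in>nilradical R. a \<otimes> b = \<zero>"
  shows "chained_or_indep (triv_ext R M)"
proof -
  have reg: "x = \<zero>" if "a \<in> carrier R" "a \<notin> nilradical R" "x \<in> carrier R" "a \<otimes> x = \<zero>" for a x
    using Z that unfolding zero_divisor_def by blast
  have rmn: "regular_mod_nil R a" if "a \<in> carrier R" "a \<notin> nilradical R" for a
    using nilpotent_power_mult[OF that(1)] reg[OF that] that(1) unfolding regular_mod_nil_def by blast
  have div: "\<exists>g\<in>carrier M. x = a \<odot>\<^bsub>M\<^esub> g" if "a \<in> carrier R" "a \<notin> nilradical R" "x \<in> carrier M" for a x
    using D rmn[OF that(1,2)] that(3) unfolding divisible_mod_nil_def by blast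
  have tf: "x = \<zero>\<^bsub>M\<^esub>"
    if "a \<in> carrier R" "a \<notin> nilradical R" "x \<in> carrier M" "a \<odot>\<^bsub>M\<^esub> x = \<zero>\<^bsub>M\<^esub>" for a x
    using T rmn[OF that(1,2)] that(3,4) unfolding torsionfree_mod_nil_def by blast
  have Nc: "a \<in> carrier R" if "a \<in> nilradical R" for a using that by (simp add: nilradical_def)
  have Nmult: "a \<otimes> x \<in> nilradical R" if a: "a \<in> nilradical R" and x: "x \<in> carrier R" for a x
  proof -
    obtain n where "a [^] (n::nat) = \<zero>" using a by (auto simp: nilradical_def)
    then have "(a \<otimes> x) [^] n = \<zero>" using x Nc[OF a] by (simp add: R.nat_pow_distrib)
    then show ?thesis using x Nc[OF a] by (auto simp: nilradical_def)
  qed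
  have sq: "a \<in> nilradical R" if "a \<in> carrier R" "a \<otimes> a = \<zero>" for a
    using that by (auto simp: nilradical_def numeral_2_eq_2 intro!: exI[of _ "2::nat"])
  have comp: "a divides b \<or> b divides a"
    if "a \<in> carrier R" "b \<in> carrier R" "a \<notin> nilradical R" for a b
    using CI that sq indep_pair_mult_zero(1) unfolding chained_or_indep_def by blast
  have dvdN: "b \<notin> nilradical R" if "b divides a" "a \<notin> nilradical R" for a b
    using that Nmult unfolding factor_def by blast
  have out: "(a, e) divides\<^bsub>triv_ext R M\<^esub> (b, f) \<or> (b, f) divides\<^bsub>triv_ext R M\<^esub> (a, e)"
    if c: "a \<in> carrier R" "b \<in> carrier R" "e \<in> carrier M" "f \<in> carrier M" and a: "a \<notin> nilradical R"
    for a b e f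
    using comp[OF c(1,2) a]
  proof
    assume "a divides b"
    then show ?thesis using triv_ext_divides_if_divisible[OF c(1,3,4)] div[OF c(1) a] by simp
  next
    assume ba: "b divides a"
    then show ?thesis
      using triv_ext_divides_if_divisible[OF c(2,4,3) ba] div[OF c(2) dvdN[OF ba a]] by simp
  qed
  \<comment> \<open>Cancelling \<open>r\<close> from \<open>r (a + d b) = 0\<close> and
    \<open>r (e + d f) = 0\<close> exhibits \<open>(a, e)\<close> as \<open>- d\<close> times
    \<open>(b, f)\<close>.\<close>
  have cancel: "(b, f) divides\<^bsub>triv_ext R M\<^esub> (a, e)"
    if c: "a \<in> carrier R" "b \<in> carrier R" "e \<in> carrier M" "f \<in> carrier M" "d \<in> carrier R"
      and r: "r \<in> carrier R" "r \<notin> nilradical R"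
      and ra: "r \<otimes> a \<oplus> (r \<otimes> d) \<otimes> b = \<zero>" and re: "r \<odot>\<^bsub>M\<^esub> e \<oplus>\<^bsub>M\<^esub> (r \<otimes> d) \<odot>\<^bsub>M\<^esub> f = \<zero>\<^bsub>M\<^esub>"
    for a b e f d r
  proof -
    have "r \<otimes> (a \<oplus> d \<otimes> b) = \<zero>" using ra c r by (simp add: R.r_distr R.m_assoc)
    then have 1: "a \<oplus> d \<otimes> b = \<zero>" using reg[OF r] c by simp
    have "r \<odot>\<^bsub>M\<^esub> (e \<oplus>\<^bsub>M\<^esub> d \<odot>\<^bsub>M\<^esub> f) = \<zero>\<^bsub>M\<^esub>" using re c r by (simp add: smult_r_distr smult_assoc1)
    then have 2: "e \<oplus>\<^bsub>M\<^esub> d \<odot>\<^bsub>M\<^esub> f = \<zero>\<^bsub>M\<^esub>" using tf[OF r] c by simp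
    have "a = \<ominus> (d \<otimes> b)" using R.minus_equality[OF 1] c by simp
    then have "a = b \<otimes> (\<ominus> d)" using c by (simp add: R.r_minus R.m_comm)
    moreover have "e = \<ominus>\<^bsub>M\<^esub> (d \<odot>\<^bsub>M\<^esub> f)" using M.minus_equality[OF 2] c by simp
    then have "e = b \<odot>\<^bsub>M\<^esub> \<zero>\<^bsub>M\<^esub> \<oplus>\<^bsub>M\<^esub> (\<ominus> d) \<odot>\<^bsub>M\<^esub> f" using c by (simp add: smult_l_minus)
    ultimately show ?thesis
      unfolding triv_ext_divides using c(5) R.a_inv_closed M.zero_closed by blast
  qed
  have "(a, e) divides\<^bsub>triv_ext R M\<^esub> (b, f) \<or> (b, f) divides\<^bsub>triv_ext R M\<^esub> (a, e) \<or>
      indep_pair (triv_ext R M) (a, e) (b, f)"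
    if c: "a \<in> carrier R" "b \<in> carrier R" "e \<in> carrier M" "f \<in> carrier M" for a b e f
  proof (cases "a \<in> nilradical R \<and> b \<in> nilradical R")
    case False
    then show ?thesis using out[OF c] out[OF c(2,1,4,3)] by blast
  next
    case True
    then have aN: "a \<in> nilradical R" and bN: "b \<in> nilradical R" by auto
    show ?thesis
    proof (cases "(a, e) divides\<^bsub>triv_ext R M\<^esub> (b, f) \<or> (b, f) divides\<^bsub>triv_ext R M\<^esub> (a, e)")
      case True
      then show ?thesis by blast
    next
      case False
      have rel: "(r \<otimes> a = \<zero> \<and> r \<otimes> b = \<zero> \<and> s \<otimes> a = \<zero> \<and> s \<otimes> b = \<zero>) \<and>
          r \<odot>\<^bsub>M\<^esub> e = \<zero>\<^bsub>M\<^esub> \<and> r \<odot>\<^bsub>M\<^esub> f = \<zero>\<^bsub>M\<^esub> \<and> s \<odot>\<^bsub>M\<^esub> e = \<zero>\<^bsub>M\<^esub> \<and> s \<odot>\<^bsub>M\<^esub> f = \<zero>\<^bsub>M\<^esub>"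
        if rs: "r \<in> carrier R" "s \<in> carrier R"
          and ra: "r \<otimes> a \<oplus> s \<otimes> b = \<zero>" and re: "r \<odot>\<^bsub>M\<^esub> e \<oplus>\<^bsub>M\<^esub> s \<odot>\<^bsub>M\<^esub> f = \<zero>\<^bsub>M\<^esub>" for r s
      proof -
        have ra': "s \<otimes> b \<oplus> r \<otimes> a = \<zero>" "s \<odot>\<^bsub>M\<^esub> f \<oplus>\<^bsub>M\<^esub> r \<odot>\<^bsub>M\<^esub> e = \<zero>\<^bsub>M\<^esub>"
          using ra re rs c by (simp_all add: R.a_comm M.a_comm)
        have 1: "\<not> r divides s" if "r \<notin> nilradical R"
          using cancel[OF c _ rs(1) that] ra re False unfolding factor_def by blast
        have 2: "\<not> s divides r" if "s \<notin> nilradical R"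
          using cancel[OF c(2,1,4,3) _ rs(2) that] ra' False unfolding factor_def by blast
        \<comment> \<open>A coefficient outside the nilradical is comparable with the other one, and
          the divisor of the two lies outside as well; cancelling it would contradict
          incomparability.\<close>
        have "r \<in> nilradical R" using 1 2 comp[OF rs] dvdN by blast
        moreover have "s \<in> nilradical R" using 1 2 comp[OF rs(2,1)] dvdN by blast
        ultimately show ?thesis using NN NM aN bN c by simp
      qed
      have "indep_pair (triv_ext R M) (a, e) (b, f)"
        unfolding indep_pair_def
      proof (intro ballI impI)
        fix u v assume uv: "u \<in> carrier (triv_ext R M)" "v \<in> carrier (triv_ext R M)"
          and 0: "u \<otimes>\<^bsub>triv_ext R M\<^esub> (a, e) \<oplus>\<^bsub>triv_ext R M\<^esub> v \<otimes>\<^bsub>triv_ext R M\<^esub> (b, f) = \<zero>\<^bsub>triv_ext R M\<^esub>"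
        obtain r x s y where rs: "u = (r, x)" "v = (s, y)" "r \<in> carrier R" "s \<in> carrier R"
          "x \<in> carrier M" "y \<in> carrier M" using uv by auto
        \<comment> \<open>As \<open>a\<close> and \<open>b\<close> annihilate \<open>M\<close>, the
          second components \<open>x\<close> and \<open>y\<close> of the multipliers
          disappear.\<close>
        have N0: "a \<odot>\<^bsub>M\<^esub> z = \<zero>\<^bsub>M\<^esub>" "b \<odot>\<^bsub>M\<^esub> z = \<zero>\<^bsub>M\<^esub>" if "z \<in> carrier M" for z
          using NM aN bN that by auto
        have "r \<otimes> a \<oplus> s \<otimes> b = \<zero>" "r \<odot>\<^bsub>M\<^esub> e \<oplus>\<^bsub>M\<^esub> s \<odot>\<^bsub>M\<^esub> f = \<zero>\<^bsub>M\<^esub>"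
          using 0 rs c by (simp_all add: N0)
        from rel[OF rs(3,4) this]
        show "u \<otimes>\<^bsub>triv_ext R M\<^esub> (a, e) = \<zero>\<^bsub>triv_ext R M\<^esub> \<and>
            u \<otimes>\<^bsub>triv_ext R M\<^esub> (b, f) = \<zero>\<^bsub>triv_ext R M\<^esub> \<and>
            v \<otimes>\<^bsub>triv_ext R M\<^esub> (a, e) = \<zero>\<^bsub>triv_ext R M\<^esub> \<and>
            v \<otimes>\<^bsub>triv_ext R M\<^esub> (b, f) = \<zero>\<^bsub>triv_ext R M\<^esub>"
          using rs c by (simp add: N0)
      qed
      then show ?thesis by blast
    qed
  qed
  then show ?thesis by (simp add: chained_or_indep_def)
qed

section \<open>Necessity of one of the two cases\<close>

text \<open>\<open>(0, e)\<close> never divides \<open>(a, 0)\<close>, so either \<open>e\<close>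
  lies in \<open>aM\<close> or the two are independent. A single \<open>e\<close> outside
  \<open>aM\<close> forces \<open>aM = 0\<close>, and then no non-zero \<open>e\<close> lies in
  \<open>aM\<close>; this makes the alternative uniform in \<open>e\<close>.\<close>

lemma smult_dichotomy:
  assumes CI: "chained_or_indep (triv_ext R M)" and a: "a \<in> carrier R" "a \<noteq> \<zero>"
  shows "(\<forall>e\<in>carrier M. \<exists>g\<in>carrier M. e = a \<odot>\<^bsub>M\<^esub> g) \<or>
    (a \<otimes> a = \<zero> \<and> (\<forall>e\<in>carrier M. a \<odot>\<^bsub>M\<^esub> e = \<zero>\<^bsub>M\<^esub>) \<and>
     (\<forall>e\<in>carrier M. e \<noteq> \<zero>\<^bsub>M\<^esub> \<longrightarrow> (\<forall>c\<in>carrier R. c \<otimes> a = \<zero> \<longleftrightarrow> c \<odot>\<^bsub>M\<^esub> e = \<zero>\<^bsub>M\<^esub>)))"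
proof -
  interpret T: cring "triv_ext R M" by (rule triv_ext_cring)
  have alt: "(\<exists>g\<in>carrier M. e = a \<odot>\<^bsub>M\<^esub> g) \<or> (a \<otimes> a = \<zero> \<and>
      (\<forall>f\<in>carrier M. a \<odot>\<^bsub>M\<^esub> f = \<zero>\<^bsub>M\<^esub>) \<and> (\<forall>c\<in>carrier R. c \<otimes> a = \<zero> \<longleftrightarrow> c \<odot>\<^bsub>M\<^esub> e = \<zero>\<^bsub>M\<^esub>))"
    if e: "e \<in> carrier M" for e
  proof -
    let ?a = "(a, \<zero>\<^bsub>M\<^esub>)" and ?e = "(\<zero>, e)"
    have ae: "?a \<in> carrier (triv_ext R M)" "?e \<in> carrier (triv_ext R M)" using a e by simp_all
    have nd: "\<not> ?e divides\<^bsub>triv_ext R M\<^esub> ?a" using a by (auto simp: triv_ext_divides)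
    have "?a divides\<^bsub>triv_ext R M\<^esub> ?e \<or> indep_pair (triv_ext R M) ?a ?e"
      using CI ae nd unfolding chained_or_indep_def by blast
    then show ?thesis
    proof
      assume "?a divides\<^bsub>triv_ext R M\<^esub> ?e"
      then show ?thesis using a e by (auto simp: triv_ext_divides)
    next
      assume I: "indep_pair (triv_ext R M) ?a ?e"
      note I' = T.indep_pair_sym[OF ae I]
      have "?a \<otimes>\<^bsub>triv_ext R M\<^esub> ?a = \<zero>\<^bsub>triv_ext R M\<^esub>" by (rule T.indep_pair_mult_zero(1)[OF ae I])
      then have 1: "a \<otimes> a = \<zero>" by simp
      have 2: "a \<odot>\<^bsub>M\<^esub> f = \<zero>\<^bsub>M\<^esub>" if f: "f \<in> carrier M" for f
      proof -
        \<comment> \<open>\<open>(0, f)\<close> annihilates \<open>(0, e)\<close>, since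
          \<open>M\<close> has square zero in the extension, and by independence it annihilates
          \<open>(a, 0)\<close> too.\<close>
        have "(\<zero>, f) \<otimes>\<^bsub>triv_ext R M\<^esub> ?a = \<zero>\<^bsub>triv_ext R M\<^esub>"
          using f e by (intro T.indep_pair_annihilator[OF ae(2,1) I']) simp_all
        then show ?thesis using a f by simp
      qed
      have 3: "c \<otimes> a = \<zero> \<longleftrightarrow> c \<odot>\<^bsub>M\<^esub> e = \<zero>\<^bsub>M\<^esub>" if c: "c \<in> carrier R" for c
      proof -
        have cc: "(c, \<zero>\<^bsub>M\<^esub>) \<in> carrier (triv_ext R M)" using c by simp
        have "(c, \<zero>\<^bsub>M\<^esub>) \<otimes>\<^bsub>triv_ext R M\<^esub> ?a = \<zero>\<^bsub>triv_ext R M\<^esub> \<longleftrightarrow>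
            (c, \<zero>\<^bsub>M\<^esub>) \<otimes>\<^bsub>triv_ext R M\<^esub> ?e = \<zero>\<^bsub>triv_ext R M\<^esub>"
          using T.indep_pair_annihilator[OF ae I cc] T.indep_pair_annihilator[OF ae(2,1) I' cc] by blast
        then show ?thesis using a c e by simp
      qed
      show ?thesis using 1 2 3 by blast
    qed
  qed
  show ?thesis
  proof (cases "\<forall>e\<in>carrier M. \<exists>g\<in>carrier M. e = a \<odot>\<^bsub>M\<^esub> g")
    case True
    then show ?thesis ..
  next
    case False
    then obtain e0 where "e0 \<in> carrier M" "\<not> (\<exists>g\<in>carrier M. e0 = a \<odot>\<^bsub>M\<^esub> g)" by blast
    then have z: "a \<otimes> a = \<zero>" "\<And>f. f \<in> carrier M \<Longrightarrow> a \<odot>\<^bsub>M\<^esub> f = \<zero>\<^bsub>M\<^esub>" using alt by blast+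
    then have "\<not> (\<exists>g\<in>carrier M. e = a \<odot>\<^bsub>M\<^esub> g)" if "e \<noteq> \<zero>\<^bsub>M\<^esub>" for e using that by auto
    then show ?thesis using z alt by blast
  qed
qed

text \<open>\<open>(0, e)\<close> is compared with \<open>(0, f)\<close>; of independence only the
  equality of annihilators is retained.\<close>

lemma cyclic_trichotomy:
  assumes CI: "chained_or_indep (triv_ext R M)" and ef: "e \<in> carrier M" "f \<in> carrier M"
  shows "(\<exists>c\<in>carrier R. f = c \<odot>\<^bsub>M\<^esub> e) \<or> (\<exists>c\<in>carrier R. e = c \<odot>\<^bsub>M\<^esub> f) \<or>
    (\<forall>c\<in>carrier R. c \<odot>\<^bsub>M\<^esub> e = \<zero>\<^bsub>M\<^esub> \<longleftrightarrow> c \<odot>\<^bsub>M\<^esub> f = \<zero>\<^bsub>M\<^esub>)"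
proof -
  interpret T: cring "triv_ext R M" by (rule triv_ext_cring)
  have c: "(\<zero>, e) \<in> carrier (triv_ext R M)" "(\<zero>, f) \<in> carrier (triv_ext R M)" using ef by simp_all
  then have "(\<zero>, e) divides\<^bsub>triv_ext R M\<^esub> (\<zero>, f) \<or> (\<zero>, f) divides\<^bsub>triv_ext R M\<^esub> (\<zero>, e) \<or>
      indep_pair (triv_ext R M) (\<zero>, e) (\<zero>, f)"
    using CI unfolding chained_or_indep_def by blast
  then show ?thesis
  proof (elim disjE)
    assume I: "indep_pair (triv_ext R M) (\<zero>, e) (\<zero>, f)"
    have "d \<odot>\<^bsub>M\<^esub> e = \<zero>\<^bsub>M\<^esub> \<longleftrightarrow> d \<odot>\<^bsub>M\<^esub> f = \<zero>\<^bsub>M\<^esub>" if d: "d \<in> carrier R" for d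
    proof -
      have dc: "(d, \<zero>\<^bsub>M\<^esub>) \<in> carrier (triv_ext R M)" using d by simp
      have "(d, \<zero>\<^bsub>M\<^esub>) \<otimes>\<^bsub>triv_ext R M\<^esub> (\<zero>, e) = \<zero>\<^bsub>triv_ext R M\<^esub> \<longleftrightarrow>
          (d, \<zero>\<^bsub>M\<^esub>) \<otimes>\<^bsub>triv_ext R M\<^esub> (\<zero>, f) = \<zero>\<^bsub>triv_ext R M\<^esub>"
        using T.indep_pair_annihilator[OF c I dc]
          T.indep_pair_annihilator[OF c(2,1) T.indep_pair_sym[OF c I] dc] by blast
      then show ?thesis using ef d by simp
    qed
    then show ?thesis by blast
  qed (use ef in \<open>auto simp: triv_ext_divides\<close>)
qed

lemma triv_ext_cases:
  assumes CI: "chained_or_indep (triv_ext R M)" and nz: "carrier M \<noteq> {\<zero>\<^bsub>M\<^esub>}"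
  shows "(valuation_domain R \<and> divisible_module R M \<and> uniserial R M) \<or>
     ((\<forall>a\<in>nilradical R. \<forall>e\<in>carrier M. a \<odot>\<^bsub>M\<^esub> e = \<zero>\<^bsub>M\<^esub>) \<and>
      divisible_mod_nil R M \<and> torsionfree_mod_nil R M \<and>
      (\<forall>a. zero_divisor R a \<longrightarrow> a \<in> nilradical R) \<and>
      (\<forall>a\<in>nilradical R. \<forall>b\<in>nilradical R. a \<otimes> b = \<zero>))"
    (is "?V \<or> ?W")
proof -
  note CIR = triv_ext_chained_or_indep_imp_base[OF CI]
  obtain e0 where e0: "e0 \<in> carrier M" "e0 \<noteq> \<zero>\<^bsub>M\<^esub>" using nz M.zero_closed by blast
  have one: "\<one> \<noteq> \<zero>" using e0 smult_one smult_l_null by metis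
  have zN: "\<zero> \<in> nilradical R" by (auto simp: nilradical_def intro: exI[of _ 1])
  have oneN: "\<one> \<notin> nilradical R" using one by (simp add: nilradical_def)
  have sqN: "a \<in> nilradical R" if "a \<in> carrier R" "a \<otimes> a = \<zero>" for a
    using that by (auto simp: nilradical_def numeral_2_eq_2 intro!: exI[of _ "2::nat"])
  \<comment> \<open>If \<open>aM = M\<close>, then powers of \<open>a\<close> act surjectively too.
    As \<open>M\<close> is non-zero, a nilpotent \<open>a\<close> therefore falls under the other
    alternative of \<open>smult_dichotomy\<close>.\<close>
  have pow: "\<exists>g\<in>carrier M. e = a [^] (n::nat) \<odot>\<^bsub>M\<^esub> g"
    if a: "a \<in> carrier R" and div: "\<forall>e\<in>carrier M. \<exists>g\<in>carrier M. e = a \<odot>\<^bsub>M\<^esub> g"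
      and e: "e \<in> carrier M" for a e n
    using e
  proof (induct n arbitrary: e)
    case 0
    then show ?case by (intro bexI[of _ e]) simp_all
  next
    case (Suc n)
    obtain g where g: "g \<in> carrier M" "e = a [^] n \<odot>\<^bsub>M\<^esub> g" using Suc by blast
    obtain h where h: "h \<in> carrier M" "g = a \<odot>\<^bsub>M\<^esub> h" using div g(1) by blast
    have "e = a [^] Suc n \<odot>\<^bsub>M\<^esub> h" using g h a by (simp add: smult_assoc1)
    then show ?case using h(1) by blast
  qed
  have nonN: "\<forall>e\<in>carrier M. \<exists>g\<in>carrier M. e = a \<odot>\<^bsub>M\<^esub> g" if "a \<in> carrier R" "a \<notin> nilradical R" for a
    using smult_dichotomy[OF CI that(1)] sqN[OF that(1)] that(2) zN by blast
  have N: "a \<otimes> a = \<zero> \<and> (\<forall>e\<in>carrier M. a \<odot>\<^bsub>M\<^esub> e = \<zero>\<^bsub>M\<^esub>) \<and>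
      (\<forall>e\<in>carrier M. e \<noteq> \<zero>\<^bsub>M\<^esub> \<longrightarrow> (\<forall>c\<in>carrier R. c \<otimes> a = \<zero> \<longleftrightarrow> c \<odot>\<^bsub>M\<^esub> e = \<zero>\<^bsub>M\<^esub>))"
    if a: "a \<in> nilradical R" "a \<noteq> \<zero>" for a
  proof -
    obtain n where n: "a \<in> carrier R" "a [^] (n::nat) = \<zero>" using a(1) by (auto simp: nilradical_def)
    have "\<not> (\<forall>e\<in>carrier M. \<exists>g\<in>carrier M. e = a \<odot>\<^bsub>M\<^esub> g)"
    proof
      assume "\<forall>e\<in>carrier M. \<exists>g\<in>carrier M. e = a \<odot>\<^bsub>M\<^esub> g"
      from pow[OF n(1) this e0(1), of n] show False using n e0 by auto
    qed
    then show ?thesis using smult_dichotomy[OF CI n(1) a(2)] by blast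
  qed
  have Nc: "a \<in> carrier R" if "a \<in> nilradical R" for a using that by (simp add: nilradical_def)
  have rmn: "a \<notin> nilradical R" if a: "regular_mod_nil R a" for a
  proof
    assume aN: "a \<in> nilradical R"
    then have "a \<otimes> \<one> \<in> nilradical R" using Nc by simp
    then show False using a oneN unfolding regular_mod_nil_def by blast
  qed
  have D: "divisible_mod_nil R M"
    unfolding divisible_mod_nil_def
  proof (intro allI impI)
    fix a assume a: "regular_mod_nil R a"
    then have "a \<in> carrier R" by (simp add: regular_mod_nil_def)
    then show "\<forall>e\<in>carrier M. \<exists>e'\<in>carrier M. e = a \<odot>\<^bsub>M\<^esub> e'" by (rule nonN[OF _ rmn[OF a]])
  qed
  have NM: "\<forall>a\<in>nilradical R. \<forall>e\<in>carrier M. a \<odot>\<^bsub>M\<^esub> e = \<zero>\<^bsub>M\<^esub>"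
  proof (intro ballI)
    fix a e assume "a \<in> nilradical R" "e \<in> carrier M"
    then show "a \<odot>\<^bsub>M\<^esub> e = \<zero>\<^bsub>M\<^esub>" using N[of a] by (cases "a = \<zero>") auto
  qed
  show ?thesis
  proof (cases "nilradical R = {\<zero>}")
    case False
    then obtain a where a: "a \<in> nilradical R" "a \<noteq> \<zero>" using zN by blast
    have NN: "\<forall>a\<in>nilradical R. \<forall>b\<in>nilradical R. a \<otimes> b = \<zero>"
    proof (intro ballI)
      fix x y assume xy: "x \<in> nilradical R" "y \<in> nilradical R"
      show "x \<otimes> y = \<zero>"
      proof (cases "y = \<zero>")
        case True
        then show ?thesis using Nc[OF xy(1)] by simp
      next
        case False
        \<comment> \<open>\<open>y\<close> and \<open>e0\<close> have the same annihilator, and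
          \<open>x\<close> kills \<open>e0\<close>.\<close>
        have "x \<odot>\<^bsub>M\<^esub> e0 = \<zero>\<^bsub>M\<^esub>" using NM xy(1) e0 by blast
        then show ?thesis using N[OF xy(2) False] e0 Nc[OF xy(1)] by blast
      qed
    qed
    \<comment> \<open>A non-nilpotent \<open>c\<close> has \<open>cM = M\<close>, so
      \<open>c b = 0\<close> gives \<open>bM = 0\<close>, and \<open>b\<close> is nilpotent. Being
      non-zero, \<open>b\<close> has the annihilator of every non-zero element of \<open>M\<close>,
      so \<open>cM = 0\<close>, which is absurd.\<close>
    have Z: "c \<in> nilradical R" if zd: "zero_divisor R c" for c
    proof (rule ccontr)
      assume cN: "c \<notin> nilradical R"
      obtain b where b: "c \<in> carrier R" "b \<in> carrier R" "b \<noteq> \<zero>" "c \<otimes> b = \<zero>"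
        using zd by (auto simp: zero_divisor_def)
      have bM: "b \<odot>\<^bsub>M\<^esub> e = \<zero>\<^bsub>M\<^esub>" if e: "e \<in> carrier M" for e
      proof -
        obtain g where g: "g \<in> carrier M" "e = c \<odot>\<^bsub>M\<^esub> g" using nonN[OF b(1) cN] e by blast
        have "b \<odot>\<^bsub>M\<^esub> e = (c \<otimes> b) \<odot>\<^bsub>M\<^esub> g"
          using g b(1,2) by (simp add: smult_assoc1[symmetric] R.m_comm)
        then show ?thesis using b(4) g(1) by simp
      qed
      have bN: "b \<in> nilradical R"
      proof (rule ccontr)
        assume "b \<notin> nilradical R"
        then obtain g where "g \<in> carrier M" "e0 = b \<odot>\<^bsub>M\<^esub> g" using nonN[OF b(2)] e0(1) by blast
        then show False using bM e0(2) by simp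
      qed
      have cM: "c \<odot>\<^bsub>M\<^esub> e = \<zero>\<^bsub>M\<^esub>" if e: "e \<in> carrier M" for e
      proof (cases "e = \<zero>\<^bsub>M\<^esub>")
        case True
        then show ?thesis using b(1) by simp
      next
        case False
        then show ?thesis using N[OF bN b(3)] b(1,4) e by blast
      qed
      obtain g where "g \<in> carrier M" "e0 = c \<odot>\<^bsub>M\<^esub> g" using nonN[OF b(1) cN] e0(1) by blast
      then show False using cM e0(2) by simp
    qed
    have T: "torsionfree_mod_nil R M"
      unfolding torsionfree_mod_nil_def
    proof (intro allI impI ballI)
      fix c e assume c: "regular_mod_nil R c" and e: "e \<in> carrier M" "c \<odot>\<^bsub>M\<^esub> e = \<zero>\<^bsub>M\<^esub>"
      have cc: "c \<in> carrier R" using c by (simp add: regular_mod_nil_def)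
      show "e = \<zero>\<^bsub>M\<^esub>"
      proof (rule ccontr)
        assume "e \<noteq> \<zero>\<^bsub>M\<^esub>"
        \<comment> \<open>The fixed non-zero nilpotent \<open>a\<close> has the same annihilator as
          \<open>e\<close>, so \<open>c\<close> is a zero-divisor and thus nilpotent.\<close>
        then have "c \<otimes> a = \<zero>" using N[OF a] e cc by blast
        then have "zero_divisor R c" using a Nc cc unfolding zero_divisor_def by blast
        then show False using Z rmn[OF c] by blast
      qed
    qed
    show ?thesis using NM D T Z NN by blast
  next
    case N0: True
    have div: "\<exists>g\<in>carrier M. e = a \<odot>\<^bsub>M\<^esub> g" if "a \<in> carrier R" "a \<noteq> \<zero>" "e \<in> carrier M" for a e
      using nonN[OF that(1)] that(2,3) N0 by blast
    \<comment> \<open>Non-zero elements act surjectively, so for non-zero \<open>a\<close> and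
      \<open>b\<close> the element \<open>e0\<close> would have the form
      \<open>a b h = 0\<close>.\<close>
    have int: "a = \<zero> \<or> b = \<zero>" if ab: "a \<in> carrier R" "b \<in> carrier R" "a \<otimes> b = \<zero>" for a b
    proof (rule ccontr)
      assume "\<not> ?thesis"
      then obtain g h where "g \<in> carrier M" "e0 = a \<odot>\<^bsub>M\<^esub> g" "h \<in> carrier M" "g = b \<odot>\<^bsub>M\<^esub> h"
        using div ab e0(1) by metis
      then have "e0 = (a \<otimes> b) \<odot>\<^bsub>M\<^esub> h" using ab(1,2) by (simp add: smult_assoc1)
      then show False using ab(3) e0 \<open>h \<in> carrier M\<close> by simp
    qed
    interpret D: domain R using one int by unfold_locales auto
    have dvd: "a divides b \<or> b divides a" if ab: "a \<in> carrier R" "b \<in> carrier R" for a b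
    proof (rule ccontr)
      assume nd: "\<not> ?thesis"
      \<comment> \<open>Independence forces \<open>a\<close> to square to zero; then
        \<open>a = 0\<close>, which \<open>b\<close> divides.\<close>
      then have "a \<otimes> a = \<zero>" using CIR ab R.indep_pair_mult_zero(1) unfolding chained_or_indep_def by blast
      then have "a = b \<otimes> \<zero>" using int ab by auto
      then show False using nd by (auto simp: factor_def)
    qed
    have V: "valuation_domain R"
      unfolding valuation_domain_def using D.domain_axioms dvd by (auto simp: factor_def)
    have "\<not> regular_elem R \<zero>" using one unfolding regular_elem_def zero_divisor_def by (auto intro: bexI[of _ \<one>])
    then have DM: "divisible_module R M"
      unfolding divisible_module_def using div unfolding regular_elem_def by metis
    show ?thesis
    proof (cases "uniserial R M")
      case True
      then show ?thesis using V DM by blast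
    next
      case False
      then obtain e f where ef: "e \<in> carrier M" "f \<in> carrier M"
        and nef: "\<not> (\<exists>c\<in>carrier R. f = c \<odot>\<^bsub>M\<^esub> e)" "\<not> (\<exists>c\<in>carrier R. e = c \<odot>\<^bsub>M\<^esub> f)"
        unfolding uniserial_iff by blast
      \<comment> \<open>If \<open>a \<noteq> \<zero>\<close> kills \<open>e\<close>, it also kills
        \<open>f\<close>. Write \<open>e = a e'\<close>; since \<open>a\<close> separates
        \<open>e'\<close> from \<open>f\<close>, these two are comparable, and only
        \<open>f = c e'\<close> is possible. Comparability of \<open>a\<close> and \<open>c\<close>
        then makes \<open>e\<close> and \<open>f\<close> comparable.\<close>
      have faith: "a = \<zero>" if a: "a \<in> carrier R" "a \<odot>\<^bsub>M\<^esub> e = \<zero>\<^bsub>M\<^esub>" for a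
      proof (rule ccontr)
        assume a0: "a \<noteq> \<zero>"
        have af: "a \<odot>\<^bsub>M\<^esub> f = \<zero>\<^bsub>M\<^esub>" using cyclic_trichotomy[OF CI ef] nef a by blast
        obtain e' where e': "e' \<in> carrier M" "e = a \<odot>\<^bsub>M\<^esub> e'" using div[OF a(1) a0 ef(1)] by blast
        have "e \<noteq> \<zero>\<^bsub>M\<^esub>" using nef(2) ef(2) smult_l_null[of f] R.zero_closed by metis
        have "\<not> (\<exists>c\<in>carrier R. e' = c \<odot>\<^bsub>M\<^esub> f)"
        proof
          assume "\<exists>c\<in>carrier R. e' = c \<odot>\<^bsub>M\<^esub> f"
          then obtain c where c: "c \<in> carrier R" "e' = c \<odot>\<^bsub>M\<^esub> f" by blast
          then have "e = (a \<otimes> c) \<odot>\<^bsub>M\<^esub> f" using e' a ef by (simp add: smult_assoc1)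
          then show False using nef(2) a c by blast
        qed
        then obtain c where c: "c \<in> carrier R" "f = c \<odot>\<^bsub>M\<^esub> e'"
          using cyclic_trichotomy[OF CI e'(1) ef(2)] a(1) af e' \<open>e \<noteq> \<zero>\<^bsub>M\<^esub>\<close> by blast
        from dvd[OF a(1) c(1)] show False
        proof
          assume "a divides c"
          then obtain d where d: "d \<in> carrier R" "c = a \<otimes> d" by (auto simp: factor_def)
          then have "f = d \<odot>\<^bsub>M\<^esub> e" using c e' a by (simp add: smult_assoc1[symmetric] R.m_comm)
          then show False using nef d by blast
        next
          assume "c divides a"
          then obtain d where d: "d \<in> carrier R" "a = c \<otimes> d" by (auto simp: factor_def)
          then have "e = d \<odot>\<^bsub>M\<^esub> f" using c e' by (simp add: smult_assoc1[symmetric] R.m_comm)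
          then show False using nef d by blast
        qed
      qed
      \<comment> \<open>A torsion element \<open>g\<close> is compared with \<open>e\<close>, whose
        annihilator is zero. Neither is a multiple of the other, so their annihilators agree,
        although some non-zero \<open>a\<close> kills \<open>g\<close>.\<close>
      have T: "torsionfree_mod_nil R M"
        unfolding torsionfree_mod_nil_def
      proof (intro allI impI ballI)
        fix a g assume ar: "regular_mod_nil R a" and g: "g \<in> carrier M" "a \<odot>\<^bsub>M\<^esub> g = \<zero>\<^bsub>M\<^esub>"
        have a: "a \<in> carrier R" "a \<noteq> \<zero>"
          using ar rmn[OF ar] zN unfolding regular_mod_nil_def by blast+
        show "g = \<zero>\<^bsub>M\<^esub>"
        proof (rule ccontr)
          assume g0: "g \<noteq> \<zero>\<^bsub>M\<^esub>"
          have "\<not> (\<exists>c\<in>carrier R. g = c \<odot>\<^bsub>M\<^esub> e)"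
          proof
            assume "\<exists>c\<in>carrier R. g = c \<odot>\<^bsub>M\<^esub> e"
            then obtain c where c: "c \<in> carrier R" "g = c \<odot>\<^bsub>M\<^esub> e" by blast
            then have "(a \<otimes> c) \<odot>\<^bsub>M\<^esub> e = \<zero>\<^bsub>M\<^esub>" using g a ef by (simp add: smult_assoc1)
            then have "a \<otimes> c = \<zero>" using faith[of "a \<otimes> c"] a c by simp
            then show False using int[OF a(1) c(1)] a(2) c g0 ef by auto
          qed
          moreover have "\<not> (\<exists>c\<in>carrier R. e = c \<odot>\<^bsub>M\<^esub> g)"
          proof
            assume "\<exists>c\<in>carrier R. e = c \<odot>\<^bsub>M\<^esub> g"
            then obtain c where c: "c \<in> carrier R" "e = c \<odot>\<^bsub>M\<^esub> g" by blast
            then have "a \<odot>\<^bsub>M\<^esub> e = c \<odot>\<^bsub>M\<^esub> (a \<odot>\<^bsub>M\<^esub> g)"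
              using a g(1) by (simp add: smult_assoc1[symmetric] R.m_comm)
            then have "a \<odot>\<^bsub>M\<^esub> e = \<zero>\<^bsub>M\<^esub>" using g(2) c(1) by simp
            then show False using faith a by blast
          qed
          ultimately have "a \<odot>\<^bsub>M\<^esub> e = \<zero>\<^bsub>M\<^esub>"
            using cyclic_trichotomy[OF CI ef(1) g(1)] a(1) g(2) by blast
          then show False using faith a by blast
        qed
      qed
      have Z: "\<forall>a. zero_divisor R a \<longrightarrow> a \<in> nilradical R"
        using int zN unfolding zero_divisor_def by blast
      show ?thesis using NM D T Z N0 by simp
    qed
  qed
qed

lemma fqp_ring_triv_ext_iff:
  assumes L: "local_cring R" and nz: "carrier M \<noteq> {\<zero>\<^bsub>M\<^esub>}"
  shows "fqp_ring (triv_ext R M) \<longleftrightarrow>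
    fqp_ring R \<and>
    ((valuation_domain R \<and> divisible_module R M \<and> uniserial R M) \<or>
     ((\<forall>a\<in>nilradical R. \<forall>e\<in>carrier M. a \<odot>\<^bsub>M\<^esub> e = \<zero>\<^bsub>M\<^esub>) \<and>
      divisible_mod_nil R M \<and> torsionfree_mod_nil R M \<and>
      (\<forall>a. zero_divisor R a \<longrightarrow> a \<in> nilradical R) \<and>
      nilradical R \<cdot>\<^bsub>R\<^esub> nilradical R = {\<zero>}))"
  unfolding local_cring.fqp_ring_iff_chained_or_indep[OF L]
    local_cring.fqp_ring_iff_chained_or_indep[OF triv_ext_local_cring[OF L]]
    nilradical_square_zero_iff
  using triv_ext_cases[OF _ nz] triv_ext_chained_or_indep_imp_base triv_ext_chained triv_ext_nonchained
  by blast

end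

theorem theorem4p2:
  fixes A :: "'a ring" and E :: "('a, 'b) module"
  assumes "local_ring A"
    and "module A E"
    and "carrier E \<noteq> {\<zero>\<^bsub>E\<^esub>}"
  shows "fqp_ring (triv_ext A E) \<longleftrightarrow>
    fqp_ring A \<and>
    ((valuation_domain A \<and> divisible_module A E \<and> uniserial A E) \<or>
     ((\<forall>a\<in>nilradical A. \<forall>e\<in>carrier E. a \<odot>\<^bsub>E\<^esub> e = \<zero>\<^bsub>E\<^esub>) \<and>
      divisible_mod_nil A E \<and> torsionfree_mod_nil A E \<and>
      (\<forall>a. zero_divisor A a \<longrightarrow> a \<in> nilradical A) \<and>
      nilradical A \<cdot>\<^bsub>A\<^esub> nilradical A = {\<zero>\<^bsub>A\<^esub>}))"
proof -
  interpret triv_ext_module A E using assms(2) by (rule triv_ext_module.intro)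
  show ?thesis using local_ring_imp_local_cring[OF assms(1)] assms(3) by (rule fqp_ring_triv_ext_iff)
qed

end
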